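(* Let $L$ be a metric signature, let $(M_i)_{i\in I}$ be a family of $L$-structures and $F$ a filter on $I$. If the Boolean algebra $\{0,1\}^F$ is atomless, then $M_F=\prod_iM_i/F\models\mathrm{SCP}$. In particular, this holds when $F$ is the Fréchet filter on $\omega$ (the filter of cofinite subsets of $\omega$).
   Context: Continuous first-order logic. The domains of (metric) $L$-structures are nonempty complete bounded metric spaces; predicates are bounded uniformly continuous real-valued maps, with bounds and moduli of uniform continuity prescribed by the signature. Formulas are built from atomic formulas (predicates, including the metric $d$, applied to terms) using continuous connectives $\mathbb R^n\to\mathbb R$ and the quantifiers $\sup,\inf$; formulas are $\mathbb R$-valued. A unary connective is a continuous map $\mathbb R\to\mathbb R$. A theory is a set of conditions such as $\varphi\le r$, with $\varphi$ a sentence and $r\in\mathbb R$. All filters are proper filters on nonempty sets. For a bounded family of reals, $\limsup_{i\to F}u_i=\inf_{J\in F}\sup_{i\in J}u_i$. Reduced products: on $\prod_i M_i$ let $d_F(a,b)=\limsup_{i\to F}d^{M_i}(a_i,b_i)$. The reduced product $M_F=\prod_i M_i/F$ has as domain the quotient of $\prod_iM_i$ by $d_F(a,b)=0$ (a complete bounded metric space); $a_F$ denotes the image of $a$; constants and functions are interpreted coordinatewise, and $p^{M_F}(a_F)=\limsup_{i\to F}p^{M_i}(a_i)$ for predicate symbols $p$. $\{0,1\}^F$ is the (classical) reduced power of the two-element Boolean algebra by $F$, i.e. the power set algebra of $I$ modulo the relation identifying $X,Y$ when they agree on a set in $F$. Palyutin formulas: the smallest set of formulas such that (1) every atomic formula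 is Palyutin; (2) if $\varphi$ is Palyutin and $C$ is a nondecreasing unary connective, then $C\varphi$ is Palyutin; (3) if $\varphi,\psi$ are Palyutin, so is $\max(\varphi,\psi)$; (4) if $\varphi$ is Palyutin and $x$ is a variable, $\inf_x\varphi$ and $\sup_x\varphi$ are Palyutin; (5) if $\varphi,\psi$ are Palyutin, $D$ is a nonincreasing unary connective with (necessarily unique) fixed point $\Delta$, and $x$ is a variable, then $\max(\inf_x\varphi,\ \sup_x\min(D\varphi,\Delta,\psi))$ is Palyutin. $\mathrm{SCP}$ is the theory consisting of the conditions \[\sup_y\Big(\inf_x\max(\varphi,D_1\psi_1,\dots,D_n\psi_n)-\max_{1\le j\le n}\inf_x\max(\varphi,D_j\psi_j)\Big)\le 0\] for all $n\ge2$, all Palyutin formulas $\varphi(x,y),\psi_1(x,y),\dots,\psi_n(x,y)$ ($x,y$ tuples of variables) and all nonincreasing unary connectives $D_1,\dots,D_n$. *)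

theory Defs
  imports "HOL-Analysis.Analysis" "HOL-Algebra.Order"
begin

section \<open>Metric signatures and structures\<close>

text \<open>
  Symbols are taken from carrier sets inside the types \<open>'f\<close>, \<open>'p\<close>, so that a signature may have
  no function symbols or no predicate symbols. Constants are function symbols of arity \<open>0\<close>.
\<close>

record ('f, 'p) msig =
  funs :: "'f set"
  preds :: "'p set"
  fun_ar :: "'f \<Rightarrow> nat"
  pred_ar :: "'p \<Rightarrow> nat"
  fun_mod :: "'f \<Rightarrow> real \<Rightarrow> real"
  pred_mod :: "'p \<Rightarrow> real \<Rightarrow> real"
  pred_lower :: "'p \<Rightarrow> real"
  pred_upper :: "'p \<Rightarrow> real"
  diam_bound :: real

definition metric_signature :: "('f, 'p) msig \<Rightarrow> bool" where
  "metric_signature L \<longleftrightarrow>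
     (\<forall>f\<in>funs L. \<forall>\<epsilon>>0. fun_mod L f \<epsilon> > 0) \<and> (\<forall>p\<in>preds L. \<forall>\<epsilon>>0. pred_mod L p \<epsilon> > 0)"

record ('f, 'p, 'a) mstr =
  mdom :: "'a set"
  dst :: "'a \<Rightarrow> 'a \<Rightarrow> real"
  fun_int :: "'f \<Rightarrow> 'a list \<Rightarrow> 'a"
  pred_int :: "'p \<Rightarrow> 'a list \<Rightarrow> real"

definition tuples :: "nat \<Rightarrow> 'a set \<Rightarrow> 'a list set" where
  "tuples n A = {xs. length xs = n \<and> set xs \<subseteq> A}"

text \<open>
  Tuples carry the maximum metric: \<open>list_all2 (\<lambda>x y. d x y < \<delta>) xs ys\<close> says that \<open>xs\<close> and \<open>ys\<close>
  are at distance less than \<open>\<delta>\<close>.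
\<close>

definition metric_structure :: "('f, 'p) msig \<Rightarrow> ('f, 'p, 'a) mstr \<Rightarrow> bool" where
  "metric_structure L M \<longleftrightarrow>
     mdom M \<noteq> {} \<and> Metric_space (mdom M) (dst M) \<and> Metric_space.mcomplete (mdom M) (dst M) \<and>
     (\<forall>x\<in>mdom M. \<forall>y\<in>mdom M. dst M x y \<le> diam_bound L) \<and>
     (\<forall>f\<in>funs L.
        (\<forall>xs\<in>tuples (fun_ar L f) (mdom M). fun_int M f xs \<in> mdom M) \<and>
        (\<forall>\<epsilon>>0. \<forall>xs\<in>tuples (fun_ar L f) (mdom M). \<forall>ys\<in>tuples (fun_ar L f) (mdom M).
           list_all2 (\<lambda>x y. dst M x y < fun_mod L f \<epsilon>) xs ys \<longrightarrow>
           dst M (fun_int M f xs) (fun_int M f ys) \<le> \<epsilon>)) \<and>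
     (\<forall>p\<in>preds L.
        (\<forall>xs\<in>tuples (pred_ar L p) (mdom M).
           pred_lower L p \<le> pred_int M p xs \<and> pred_int M p xs \<le> pred_upper L p) \<and>
        (\<forall>\<epsilon>>0. \<forall>xs\<in>tuples (pred_ar L p) (mdom M). \<forall>ys\<in>tuples (pred_ar L p) (mdom M).
           list_all2 (\<lambda>x y. dst M x y < pred_mod L p \<epsilon>) xs ys \<longrightarrow>
           \<bar>pred_int M p xs - pred_int M p ys\<bar> \<le> \<epsilon>))"


section \<open>Continuous formulas\<close>

datatype 'f trm = Var nat | App 'f "'f trm list"

text \<open>
  An \<open>n\<close>-ary connective is a function on the coordinates \<open>0, \<dots>, n - 1\<close>. The datatype itself admits
  arbitrary connectives and symbols; the \<open>L\<close>-formulas are singled out by \<open>is_formula\<close> below.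
\<close>

datatype ('f, 'p) fm =
    DistF "'f trm" "'f trm"
  | PredF 'p "'f trm list"
  | ConnF "(nat \<Rightarrow> real) \<Rightarrow> real" "('f, 'p) fm list"
  | SupF nat "('f, 'p) fm"
  | InfF nat "('f, 'p) fm"

fun is_term :: "('f, 'p) msig \<Rightarrow> 'f trm \<Rightarrow> bool" where
  "is_term L (Var x) \<longleftrightarrow> True"
| "is_term L (App f ts) \<longleftrightarrow> f \<in> funs L \<and> length ts = fun_ar L f \<and> (\<forall>t\<in>set ts. is_term L t)"

fun is_formula :: "('f, 'p) msig \<Rightarrow> ('f, 'p) fm \<Rightarrow> bool" where
  "is_formula L (DistF s t) \<longleftrightarrow> is_term L s \<and> is_term L t"
| "is_formula L (PredF p ts) \<longleftrightarrow>
     p \<in> preds L \<and> length ts = pred_ar L p \<and> (\<forall>t\<in>set ts. is_term L t)"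
| "is_formula L (ConnF c \<phi>s) \<longleftrightarrow>
     continuous_map (product_topology (\<lambda>_. euclideanreal) {..<length \<phi>s}) euclideanreal c \<and>
     (\<forall>\<phi>\<in>set \<phi>s. is_formula L \<phi>)"
| "is_formula L (SupF x \<phi>) \<longleftrightarrow> is_formula L \<phi>"
| "is_formula L (InfF x \<phi>) \<longleftrightarrow> is_formula L \<phi>"

fun fv_term :: "'f trm \<Rightarrow> nat set" where
  "fv_term (Var x) = {x}"
| "fv_term (App f ts) = (\<Union>t\<in>set ts. fv_term t)"

fun fv :: "('f, 'p) fm \<Rightarrow> nat set" where
  "fv (DistF s t) = fv_term s \<union> fv_term t"
| "fv (PredF p ts) = (\<Union>t\<in>set ts. fv_term t)"
| "fv (ConnF c \<phi>s) = (\<Union>\<phi>\<in>set \<phi>s. fv \<phi>)"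
| "fv (SupF x \<phi>) = fv \<phi> - {x}"
| "fv (InfF x \<phi>) = fv \<phi> - {x}"

definition is_sentence :: "('f, 'p) msig \<Rightarrow> ('f, 'p) fm \<Rightarrow> bool" where
  "is_sentence L \<phi> \<longleftrightarrow> is_formula L \<phi> \<and> fv \<phi> = {}"

fun val_term :: "('f, 'p, 'a) mstr \<Rightarrow> (nat \<Rightarrow> 'a) \<Rightarrow> 'f trm \<Rightarrow> 'a" where
  "val_term M v (Var x) = v x"
| "val_term M v (App f ts) = fun_int M f (map (val_term M v) ts)"

fun val :: "('f, 'p, 'a) mstr \<Rightarrow> (nat \<Rightarrow> 'a) \<Rightarrow> ('f, 'p) fm \<Rightarrow> real" where
  "val M v (DistF s t) = dst M (val_term M v s) (val_term M v t)"
| "val M v (PredF p ts) = pred_int M p (map (val_term M v) ts)"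
| "val M v (ConnF c \<phi>s) = c (\<lambda>k\<in>{..<length \<phi>s}. map (val M v) \<phi>s ! k)"
| "val M v (SupF x \<phi>) = (SUP a\<in>mdom M. val M (v(x := a)) \<phi>)"
| "val M v (InfF x \<phi>) = (INF a\<in>mdom M. val M (v(x := a)) \<phi>)"

text \<open>
  A pair \<open>(\<phi>, r)\<close> stands for the condition \<open>\<phi> \<le> r\<close>. The value of a sentence does not depend on the
  assignment of elements of the (nonempty) domain to the variables.
\<close>

definition models ::
    "('f, 'p, 'a) mstr \<Rightarrow> (('f, 'p) fm \<times> real) set \<Rightarrow> bool" (infix \<open>\<Turnstile>\<^sub>m\<close> 50) where
  "M \<Turnstile>\<^sub>m T \<longleftrightarrow> (\<forall>(\<phi>, r)\<in>T. \<forall>v. range v \<subseteq> mdom M \<longrightarrow> val M v \<phi> \<le> r)"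

definition UnF :: "(real \<Rightarrow> real) \<Rightarrow> ('f, 'p) fm \<Rightarrow> ('f, 'p) fm" where
  "UnF C \<phi> = ConnF (\<lambda>z. C (z 0)) [\<phi>]"

definition ConstF :: "real \<Rightarrow> ('f, 'p) fm" where
  "ConstF r = ConnF (\<lambda>z. r) []"

definition MaxF :: "('f, 'p) fm list \<Rightarrow> ('f, 'p) fm" where
  "MaxF \<phi>s = ConnF (\<lambda>z. MAX k\<in>{..<length \<phi>s}. z k) \<phi>s"

definition MinF :: "('f, 'p) fm list \<Rightarrow> ('f, 'p) fm" where
  "MinF \<phi>s = ConnF (\<lambda>z. MIN k\<in>{..<length \<phi>s}. z k) \<phi>s"

definition DiffF :: "('f, 'p) fm \<Rightarrow> ('f, 'p) fm \<Rightarrow> ('f, 'p) fm" where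
  "DiffF \<phi> \<psi> = ConnF (\<lambda>z. z 0 - z 1) [\<phi>, \<psi>]"

abbreviation SupsF :: "nat list \<Rightarrow> ('f, 'p) fm \<Rightarrow> ('f, 'p) fm" where
  "SupsF xs \<phi> \<equiv> foldr SupF xs \<phi>"

abbreviation InfsF :: "nat list \<Rightarrow> ('f, 'p) fm \<Rightarrow> ('f, 'p) fm" where
  "InfsF xs \<phi> \<equiv> foldr InfF xs \<phi>"


section \<open>Palyutin formulas and SCP\<close>

abbreviation unary_connective :: "(real \<Rightarrow> real) \<Rightarrow> bool" where
  "unary_connective C \<equiv> continuous_on UNIV C"

lemma continuous_map_coord:
  "k < n \<Longrightarrow> continuous_map (product_topology (\<lambda>_. euclideanreal) {..<n}) euclideanreal (\<lambda>z. z k)"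
  by (rule continuous_map_product_projection) simp

lemma is_formula_UnF:
  assumes "is_formula L \<phi>" "unary_connective C"
  shows "is_formula L (UnF C \<phi>)"
proof -
  have "continuous_map (product_topology (\<lambda>_. euclideanreal) {..<1::nat}) euclideanreal (C \<circ> (\<lambda>z. z 0))"
    using assms(2) by (intro continuous_map_compose[OF continuous_map_coord]) auto
  then show ?thesis
    using assms(1) by (simp add: UnF_def o_def)
qed

lemma continuous_map_Max_coord:
  "0 < m \<Longrightarrow> m \<le> (n::nat) \<Longrightarrow>
   continuous_map (product_topology (\<lambda>_. euclideanreal) {..<n}) euclideanreal (\<lambda>z. MAX k\<in>{..<m}. z k)"
proof (induction m)
  case (Suc m)
  show ?case
  proof (cases "m = 0")
    case True
    then show ?thesis using Suc.prems by (simp add: lessThan_Suc continuous_map_coord)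
  next
    case False
    then have "(MAX k\<in>{..<Suc m}. z k) = max (z m) (MAX k\<in>{..<m}. z k)" for z :: "nat \<Rightarrow> real"
      by (subst lessThan_Suc, subst image_insert, subst Max_insert) (auto simp: lessThan_empty_iff)
    then show ?thesis
      using Suc False by (simp add: continuous_map_real_max continuous_map_coord)
  qed
qed simp

lemma continuous_map_Min_coord:
  "0 < m \<Longrightarrow> m \<le> (n::nat) \<Longrightarrow>
   continuous_map (product_topology (\<lambda>_. euclideanreal) {..<n}) euclideanreal (\<lambda>z. MIN k\<in>{..<m}. z k)"
proof (induction m)
  case (Suc m)
  show ?case
  proof (cases "m = 0")
    case True
    then show ?thesis using Suc.prems by (simp add: lessThan_Suc continuous_map_coord)
  next
    case False
    then have "(MIN k\<in>{..<Suc m}. z k) = min (z m) (MIN k\<in>{..<m}. z k)" for z :: "nat \<Rightarrow> real"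
      by (subst lessThan_Suc, subst image_insert, subst Min_insert) (auto simp: lessThan_empty_iff)
    then show ?thesis
      using Suc False by (simp add: continuous_map_real_min continuous_map_coord)
  qed
qed simp

lemma is_formula_MaxF: "\<phi>s \<noteq> [] \<Longrightarrow> \<forall>\<phi>\<in>set \<phi>s. is_formula L \<phi> \<Longrightarrow> is_formula L (MaxF \<phi>s)"
  unfolding MaxF_def is_formula.simps by (intro conjI continuous_map_Max_coord) auto

lemma is_formula_MinF: "\<phi>s \<noteq> [] \<Longrightarrow> \<forall>\<phi>\<in>set \<phi>s. is_formula L \<phi> \<Longrightarrow> is_formula L (MinF \<phi>s)"
  unfolding MinF_def is_formula.simps by (intro conjI continuous_map_Min_coord) auto

lemma is_formula_ConstF: "is_formula L (ConstF r)"
  by (simp add: ConstF_def)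

lemma is_formula_DiffF: "is_formula L \<phi> \<Longrightarrow> is_formula L \<psi> \<Longrightarrow> is_formula L (DiffF \<phi> \<psi>)"
  unfolding DiffF_def is_formula.simps
  by (intro conjI continuous_map_diff continuous_map_coord) auto

lemma is_formula_SupsF: "is_formula L (SupsF xs \<phi>) \<longleftrightarrow> is_formula L \<phi>"
  by (induction xs) auto

lemma is_formula_InfsF: "is_formula L (InfsF xs \<phi>) \<longleftrightarrow> is_formula L \<phi>"
  by (induction xs) auto

lemma fv_SupsF: "fv (SupsF xs \<phi>) = fv \<phi> - set xs"
  by (induction xs) auto

lemma fv_InfsF: "fv (InfsF xs \<phi>) = fv \<phi> - set xs"
  by (induction xs) auto

inductive palyutin :: "('f, 'p) msig \<Rightarrow> ('f, 'p) fm \<Rightarrow> bool" for L where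
  pal_dist: "is_formula L (DistF s t) \<Longrightarrow> palyutin L (DistF s t)"
| pal_pred: "is_formula L (PredF p ts) \<Longrightarrow> palyutin L (PredF p ts)"
| pal_conn: "palyutin L \<phi> \<Longrightarrow> unary_connective C \<Longrightarrow> mono C \<Longrightarrow> palyutin L (UnF C \<phi>)"
| pal_max: "palyutin L \<phi> \<Longrightarrow> palyutin L \<psi> \<Longrightarrow> palyutin L (MaxF [\<phi>, \<psi>])"
| pal_inf: "palyutin L \<phi> \<Longrightarrow> palyutin L (InfF x \<phi>)"
| pal_sup: "palyutin L \<phi> \<Longrightarrow> palyutin L (SupF x \<phi>)"
| pal_fix: "palyutin L \<phi> \<Longrightarrow> palyutin L \<psi> \<Longrightarrow> unary_connective D \<Longrightarrow> antimono D \<Longrightarrow> D \<Delta> = \<Delta> \<Longrightarrow>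
            palyutin L (MaxF [InfF x \<phi>, SupF x (MinF [UnF D \<phi>, ConstF \<Delta>, \<psi>])])"

definition scp_sentence ::
    "nat list \<Rightarrow> nat list \<Rightarrow> ('f, 'p) fm \<Rightarrow> (real \<Rightarrow> real) list \<Rightarrow> ('f, 'p) fm list \<Rightarrow> ('f, 'p) fm" where
  "scp_sentence xs ys \<phi> Ds \<psi>s =
     SupsF ys (DiffF (InfsF xs (MaxF (\<phi> # map2 UnF Ds \<psi>s)))
                     (MaxF (map2 (\<lambda>D \<psi>. InfsF xs (MaxF [\<phi>, UnF D \<psi>])) Ds \<psi>s)))"

definition SCP :: "('f, 'p) msig \<Rightarrow> (('f, 'p) fm \<times> real) set" where
  "SCP L = {(scp_sentence xs ys \<phi> Ds \<psi>s, 0) |xs ys \<phi> Ds \<psi>s.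
     length Ds \<ge> 2 \<and> length \<psi>s = length Ds \<and> distinct (xs @ ys) \<and>
     (\<forall>\<theta>\<in>set (\<phi> # \<psi>s). palyutin L \<theta> \<and> fv \<theta> \<subseteq> set xs \<union> set ys) \<and>
     (\<forall>D\<in>set Ds. unary_connective D \<and> antimono D)}"


lemma palyutin_imp_formula: "palyutin L \<phi> \<Longrightarrow> is_formula L \<phi>"
proof (induction rule: palyutin.induct)
  case (pal_fix \<phi> \<psi> D \<Delta> x)
  have "is_formula L (MinF [UnF D \<phi>, ConstF \<Delta>, \<psi>])"
    using pal_fix by (intro is_formula_MinF) (auto intro: is_formula_UnF is_formula_ConstF)
  then show ?case
    using pal_fix by (intro is_formula_MaxF) auto
qed (auto intro: is_formula_UnF is_formula_MaxF)

lemma SCP_sentences: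
  assumes "(\<sigma>, r) \<in> SCP L"
  shows "is_sentence L \<sigma>"
proof -
  obtain xs ys \<phi> Ds \<psi>s where \<sigma>: "\<sigma> = scp_sentence xs ys \<phi> Ds \<psi>s"
    and len: "length Ds \<ge> 2" "length \<psi>s = length Ds"
    and pal: "\<And>\<theta>. \<theta> \<in> set (\<phi> # \<psi>s) \<Longrightarrow> palyutin L \<theta> \<and> fv \<theta> \<subseteq> set xs \<union> set ys"
    and D: "\<And>D. D \<in> set Ds \<Longrightarrow> unary_connective D \<and> antimono D"
    using assms unfolding SCP_def by blast
  have ne: "zip Ds \<psi>s \<noteq> []"
    using len by (cases Ds; cases \<psi>s) auto
  have pair: "is_formula L \<phi>" "is_formula L (UnF D \<psi>)"
      "fv (UnF D \<psi>) \<subseteq> set xs \<union> set ys" "fv \<phi> \<subseteq> set xs \<union> set ys"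
    if "(D, \<psi>) \<in> set (zip Ds \<psi>s)" for D \<psi>
  proof -
    have "D \<in> set Ds" "\<psi> \<in> set \<psi>s"
      using that by (auto dest: set_zip_leftD set_zip_rightD)
    then show "is_formula L \<phi>" "is_formula L (UnF D \<psi>)"
        "fv (UnF D \<psi>) \<subseteq> set xs \<union> set ys" "fv \<phi> \<subseteq> set xs \<union> set ys"
      using pal[of \<phi>] pal[of \<psi>] D[of D]
      by (auto intro: is_formula_UnF palyutin_imp_formula simp: UnF_def[of D \<psi>, THEN arg_cong[where f = fv]])
  qed
  have "is_formula L (MaxF (\<phi> # map2 UnF Ds \<psi>s))"
    using ne pair pal[of \<phi>] by (intro is_formula_MaxF) (auto intro: palyutin_imp_formula)
  moreover have "is_formula L (MaxF (map2 (\<lambda>D \<psi>. InfsF xs (MaxF [\<phi>, UnF D \<psi>])) Ds \<psi>s))"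
    using ne pair by (intro is_formula_MaxF) (auto simp: is_formula_InfsF intro!: is_formula_MaxF)
  moreover have "fv \<sigma> = {}"
    using pair pal[of \<phi>]
    by (fastforce simp: \<sigma> scp_sentence_def fv_SupsF fv_InfsF DiffF_def MaxF_def)
  ultimately show ?thesis
    by (simp add: is_sentence_def \<sigma> scp_sentence_def is_formula_SupsF is_formula_InfsF is_formula_DiffF)
qed


section \<open>Reduced products\<close>

text \<open>
  Filters live on the index type \<open>'i\<close>; a set \<open>J\<close> belongs to \<open>F\<close> iff \<open>\<forall>\<^sub>F i in F. i \<in> J\<close>, and \<open>F\<close> is
  proper iff \<open>F \<noteq> bot\<close>. The library's \<open>Limsup\<close> needs a complete lattice, so the limit superior of a
  bounded real family is written out with the conditionally complete operations.
\<close>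

definition flimsup :: "'i filter \<Rightarrow> ('i \<Rightarrow> real) \<Rightarrow> real" where
  "flimsup F u = (INF J\<in>{J. \<forall>\<^sub>F i in F. i \<in> J}. SUP i\<in>J. u i)"

definition prod_dom :: "('i \<Rightarrow> ('f, 'p, 'a) mstr) \<Rightarrow> ('i \<Rightarrow> 'a) set" where
  "prod_dom M = (\<Pi> i\<in>UNIV. mdom (M i))"

definition red_rel :: "'i filter \<Rightarrow> ('i \<Rightarrow> ('f, 'p, 'a) mstr) \<Rightarrow> (('i \<Rightarrow> 'a) \<times> ('i \<Rightarrow> 'a)) set" where
  "red_rel F M = {(a, b). a \<in> prod_dom M \<and> b \<in> prod_dom M \<and> flimsup F (\<lambda>i. dst (M i) (a i) (b i)) = 0}"

definition red_class :: "'i filter \<Rightarrow> ('i \<Rightarrow> ('f, 'p, 'a) mstr) \<Rightarrow> ('i \<Rightarrow> 'a) \<Rightarrow> ('i \<Rightarrow> 'a) set" where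
  "red_class F M a = red_rel F M `` {a}"

definition rep :: "'b set \<Rightarrow> 'b" where
  "rep A = (SOME a. a \<in> A)"

text \<open>
  The interpretations are read off from chosen representatives; the choice is irrelevant by
  \<open>red_dst\<close>, \<open>red_pred\<close> and \<open>red_fun\<close> below. The metric is set to \<open>0\<close> off the domain because
  \<^locale>\<open>Metric_space\<close> asks for nonnegativity and symmetry on the whole type.
\<close>

definition reduced_product ::
    "'i filter \<Rightarrow> ('i \<Rightarrow> ('f, 'p, 'a) mstr) \<Rightarrow> ('f, 'p, ('i \<Rightarrow> 'a) set) mstr" where
  "reduced_product F M =
     \<lparr> mdom = prod_dom M // red_rel F M,
       dst = (\<lambda>A B. if A \<in> prod_dom M // red_rel F M \<and> B \<in> prod_dom M // red_rel F M
                    then flimsup F (\<lambda>i. dst (M i) (rep A i) (rep B i)) else 0),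
       fun_int = (\<lambda>f As. red_class F M (\<lambda>i. fun_int (M i) f (map (\<lambda>A. rep A i) As))),
       pred_int = (\<lambda>p As. flimsup F (\<lambda>i. pred_int (M i) p (map (\<lambda>A. rep A i) As))) \<rparr>"


lemma flimsup_less:
  assumes "F \<noteq> bot" "\<And>i. \<bar>u i\<bar> \<le> B" "flimsup F u < c"
  shows "\<forall>\<^sub>F i in F. u i < c"
proof -
  have bdd: "bdd_above (u ` J)" for J
    using assms(2) by (intro bdd_aboveI2[where M = B]) (simp add: abs_le_iff)
  have "- B \<le> (SUP i\<in>J. u i)" if J: "\<forall>\<^sub>F i in F. i \<in> J" for J
  proof -
    obtain i where "i \<in> J" using J assms(1) eventually_happens' by blast
    then show ?thesis
      using assms(2)[of i] by (intro cSUP_upper2[OF bdd]) (auto simp: abs_le_iff)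
  qed
  then have "bdd_below ((\<lambda>J. SUP i\<in>J. u i) ` {J. \<forall>\<^sub>F i in F. i \<in> J})"
    by (intro bdd_belowI2[where m = "- B"]) auto
  moreover have "{J. \<forall>\<^sub>F i in F. i \<in> J} \<noteq> {}"
    by (auto intro!: exI[of _ UNIV])
  ultimately obtain J where J: "\<forall>\<^sub>F i in F. i \<in> J" "(SUP i\<in>J. u i) < c"
    using assms(3) unfolding flimsup_def by (subst (asm) cINF_less_iff) auto
  have "u i < c" if "i \<in> J" for i
    using cSUP_upper[OF that bdd] J(2) by linarith
  then show ?thesis
    using J(1) by (auto elim: eventually_mono)
qed

lemma flimsup_le:
  assumes "F \<noteq> bot" "\<And>i. \<bar>u i\<bar> \<le> B" "\<forall>\<^sub>F i in F. u i \<le> c"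
  shows "flimsup F u \<le> c"
proof -
  have bdd: "bdd_above (u ` J)" for J
    using assms(2) by (intro bdd_aboveI2[where M = B]) (simp add: abs_le_iff)
  have "- B \<le> (SUP i\<in>J. u i)" if J: "\<forall>\<^sub>F i in F. i \<in> J" for J
  proof -
    obtain i where "i \<in> J" using J assms(1) eventually_happens' by blast
    then show ?thesis
      using assms(2)[of i] by (intro cSUP_upper2[OF bdd]) (auto simp: abs_le_iff)
  qed
  then have "bdd_below ((\<lambda>J. SUP i\<in>J. u i) ` {J. \<forall>\<^sub>F i in F. i \<in> J})"
    by (intro bdd_belowI2[where m = "- B"]) auto
  then have "flimsup F u \<le> (SUP i\<in>{i. u i \<le> c}. u i)"
    unfolding flimsup_def using assms(3) by (intro cINF_lower) auto
  also have "\<dots> \<le> c"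
    using assms(1,3) by (intro cSUP_least) (auto dest: eventually_happens')
  finally show ?thesis .
qed

lemma flimsup_ge:
  assumes "F \<noteq> bot" "\<And>i. \<bar>u i\<bar> \<le> B" "\<And>i. c \<le> u i"
  shows "c \<le> flimsup F u"
proof (rule ccontr)
  assume "\<not> c \<le> flimsup F u"
  then have "\<forall>\<^sub>F i in F. u i < c"
    using flimsup_less[OF assms(1,2)] by simp
  then show False
    using assms(1,3) eventually_happens' by (meson not_le)
qed

lemma flimsup_cong:
  assumes "F \<noteq> bot" "\<And>i. \<bar>u i\<bar> \<le> B" "\<And>i. \<bar>v i\<bar> \<le> B"
    and "\<And>\<epsilon>. \<epsilon> > 0 \<Longrightarrow> \<forall>\<^sub>F i in F. \<bar>u i - v i\<bar> \<le> \<epsilon>"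
  shows "flimsup F u = flimsup F v"
proof -
  have le: "flimsup F u \<le> flimsup F v"
    if "\<And>i. \<bar>u i\<bar> \<le> B" "\<And>i. \<bar>v i\<bar> \<le> B" "\<And>\<epsilon>. \<epsilon> > 0 \<Longrightarrow> \<forall>\<^sub>F i in F. \<bar>u i - v i\<bar> \<le> \<epsilon>" for u v
  proof (rule field_le_epsilon)
    fix e :: real assume "e > 0"
    then have "\<forall>\<^sub>F i in F. v i < flimsup F v + e / 2" "\<forall>\<^sub>F i in F. \<bar>u i - v i\<bar> \<le> e / 2"
      using flimsup_less[OF assms(1) that(2), of "\<lambda>i. i" "flimsup F v + e / 2"] that(3)[of "e / 2"] by auto
    then have "\<forall>\<^sub>F i in F. u i \<le> flimsup F v + e"
    proof eventually_elim
      case (elim i)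
      then show ?case by linarith
    qed
    then show "flimsup F u \<le> flimsup F v + e"
      by (rule flimsup_le[OF assms(1) that(1)])
  qed
  show ?thesis
    using le[of u v] le[of v u] assms by (simp add: abs_minus_commute)
qed

locale structure_family =
  fixes L :: "('f, 'p) msig" and F :: "'i filter" and M :: "'i \<Rightarrow> ('f, 'p, 'a) mstr"
  assumes signature: "metric_signature L"
    and proper: "F \<noteq> bot"
    and struct: "\<And>i. metric_structure L (M i)"
begin

lemma metric: "Metric_space (mdom (M i)) (dst (M i))"
  using struct[of i] by (simp add: metric_structure_def)

lemma dst_le: "a \<in> prod_dom M \<Longrightarrow> b \<in> prod_dom M \<Longrightarrow> \<bar>dst (M i) (a i) (b i)\<bar> \<le> diam_bound L"
  using struct[of i] Metric_space.nonneg[OF metric]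
  by (auto simp: metric_structure_def prod_dom_def Pi_iff)

lemma red_rel_iff:
  "(a, b) \<in> red_rel F M \<longleftrightarrow>
     a \<in> prod_dom M \<and> b \<in> prod_dom M \<and> (\<forall>\<epsilon>>0. \<forall>\<^sub>F i in F. dst (M i) (a i) (b i) < \<epsilon>)"
proof -
  have "flimsup F (\<lambda>i. dst (M i) (a i) (b i)) = 0 \<longleftrightarrow> (\<forall>\<epsilon>>0. \<forall>\<^sub>F i in F. dst (M i) (a i) (b i) < \<epsilon>)"
    if ab: "a \<in> prod_dom M" "b \<in> prod_dom M"
  proof
    assume "flimsup F (\<lambda>i. dst (M i) (a i) (b i)) = 0"
    then show "\<forall>\<epsilon>>0. \<forall>\<^sub>F i in F. dst (M i) (a i) (b i) < \<epsilon>"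
      using flimsup_less[OF proper dst_le[OF ab]] by auto
  next
    assume ev: "\<forall>\<epsilon>>0. \<forall>\<^sub>F i in F. dst (M i) (a i) (b i) < \<epsilon>"
    have "flimsup F (\<lambda>i. dst (M i) (a i) (b i)) \<le> 0 + e" if "e > 0" for e
      using ev that by (intro flimsup_le[OF proper dst_le[OF ab]]) (auto elim!: eventually_mono intro: less_imp_le)
    then have "flimsup F (\<lambda>i. dst (M i) (a i) (b i)) \<le> 0"
      by (rule field_le_epsilon)
    moreover have "0 \<le> flimsup F (\<lambda>i. dst (M i) (a i) (b i))"
      by (intro flimsup_ge[OF proper dst_le[OF ab]] Metric_space.nonneg[OF metric])
    ultimately show "flimsup F (\<lambda>i. dst (M i) (a i) (b i)) = 0" by simp
  qed
  then show ?thesis by (auto simp: red_rel_def)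
qed

lemma equiv_red_rel: "equiv (prod_dom M) (red_rel F M)"
proof (rule equivI)
  show "red_rel F M \<subseteq> prod_dom M \<times> prod_dom M"
    by (auto simp: red_rel_def)
  show "refl_on (prod_dom M) (red_rel F M)"
  proof (rule refl_onI)
    fix a assume a: "a \<in> prod_dom M"
    then have "dst (M i) (a i) (a i) = 0" for i
      using Metric_space.zero[OF metric, of "a i" i "a i"] by (simp add: prod_dom_def Pi_iff)
    then show "(a, a) \<in> red_rel F M"
      using a by (simp add: red_rel_iff)
  qed
  show "sym (red_rel F M)"
    by (auto simp: sym_on_def red_rel_iff Metric_space.commute[OF metric])
  show "trans (red_rel F M)"
  proof (rule transI)
    fix a b c assume ab: "(a, b) \<in> red_rel F M" and bc: "(b, c) \<in> red_rel F M"
    have "\<forall>\<^sub>F i in F. dst (M i) (a i) (c i) < e" if "e > 0" for e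
    proof -
      have "e / 2 > 0" using that by simp
      then have "\<forall>\<^sub>F i in F. dst (M i) (a i) (b i) < e / 2" "\<forall>\<^sub>F i in F. dst (M i) (b i) (c i) < e / 2"
        using ab bc unfolding red_rel_iff by blast+
      then show ?thesis
      proof eventually_elim
        case (elim i)
        have "dst (M i) (a i) (c i) \<le> dst (M i) (a i) (b i) + dst (M i) (b i) (c i)"
          using ab bc
          by (intro Metric_space.triangle[OF metric]) (auto simp: red_rel_def prod_dom_def Pi_iff)
        then show ?case using elim by simp
      qed
    qed
    then show "(a, c) \<in> red_rel F M"
      using ab bc by (auto simp: red_rel_iff)
  qed
qed

lemma rep_red_class: "a \<in> prod_dom M \<Longrightarrow> (a, rep (red_class F M a)) \<in> red_rel F M"
proof -
  assume "a \<in> prod_dom M"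
  then have "a \<in> red_class F M a"
    unfolding red_class_def by (rule equiv_class_self[OF equiv_red_rel])
  then have "rep (red_class F M a) \<in> red_class F M a"
    unfolding rep_def by (rule someI[of "\<lambda>b. b \<in> red_class F M a"])
  then show ?thesis
    by (simp add: red_class_def)
qed

lemma reps_close:
  assumes "set as \<subseteq> prod_dom M" "\<delta> > 0"
  shows "\<forall>\<^sub>F i in F. list_all2 (\<lambda>x y. dst (M i) x y < \<delta>)
           (map (\<lambda>a. a i) as) (map (\<lambda>A. rep A i) (map (red_class F M) as))"
proof -
  have "\<forall>\<^sub>F i in F. \<forall>a\<in>set as. dst (M i) (a i) (rep (red_class F M a) i) < \<delta>"
    using assms rep_red_class by (intro eventually_ball_finite) (auto simp: red_rel_iff)
  then show ?thesis
    by eventually_elim (auto simp: list_all2_map1 list_all2_map2 list_all2_same)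
qed

lemma coords_tuples:
  assumes "set as \<subseteq> prod_dom M" "length as = n"
  shows "map (\<lambda>a. a i) as \<in> tuples n (mdom (M i))"
    and "map (\<lambda>A. rep A i) (map (red_class F M) as) \<in> tuples n (mdom (M i))"
  using assms rep_red_class by (auto simp: tuples_def red_rel_def prod_dom_def Pi_iff subset_iff)

theorem red_dst:
  assumes a: "a \<in> prod_dom M" and b: "b \<in> prod_dom M"
  shows "dst (reduced_product F M) (red_class F M a) (red_class F M b) =
           flimsup F (\<lambda>i. dst (M i) (a i) (b i))"
proof -
  define a' where "a' = rep (red_class F M a)"
  define b' where "b' = rep (red_class F M b)"
  have aa: "(a, a') \<in> red_rel F M" and bb: "(b, b') \<in> red_rel F M"
    using a b rep_red_class by (auto simp: a'_def b'_def)
  then have mem: "a' \<in> prod_dom M" "b' \<in> prod_dom M"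
    by (auto simp: red_rel_def)
  have "flimsup F (\<lambda>i. dst (M i) (a' i) (b' i)) = flimsup F (\<lambda>i. dst (M i) (a i) (b i))"
  proof (rule flimsup_cong[OF proper dst_le[OF mem] dst_le[OF a b]])
    fix e :: real assume "e > 0"
    then have "e / 2 > 0" by simp
    then have "\<forall>\<^sub>F i in F. dst (M i) (a i) (a' i) < e / 2" "\<forall>\<^sub>F i in F. dst (M i) (b i) (b' i) < e / 2"
      using aa bb unfolding red_rel_iff by blast+
    then show "\<forall>\<^sub>F i in F. \<bar>dst (M i) (a' i) (b' i) - dst (M i) (a i) (b i)\<bar> \<le> e"
    proof eventually_elim
      case (elim i)
      interpret Metric_space "mdom (M i)" "dst (M i)" by (rule metric)
      have "a i \<in> mdom (M i)" "b i \<in> mdom (M i)" "a' i \<in> mdom (M i)" "b' i \<in> mdom (M i)"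
        using a b mem by (auto simp: prod_dom_def Pi_iff)
      then have "dst (M i) (a i) (b i) \<le> dst (M i) (a i) (a' i) + dst (M i) (a' i) (b' i) + dst (M i) (b i) (b' i)"
        "dst (M i) (a' i) (b' i) \<le> dst (M i) (a i) (a' i) + dst (M i) (a i) (b i) + dst (M i) (b i) (b' i)"
        using triangle[of "a i" "a' i" "b i"] triangle[of "a' i" "b' i" "b i"]
          triangle[of "a' i" "a i" "b' i"] triangle[of "a i" "b i" "b' i"]
        by (auto simp: commute[of "a' i" "a i"] commute[of "b' i" "b i"])
      then show ?case using elim by linarith
    qed
  qed
  then show ?thesis
    using a b by (simp add: reduced_product_def a'_def b'_def red_class_def quotientI)
qed

theorem red_pred:
  assumes p: "p \<in> preds L" and as: "set as \<subseteq> prod_dom M" "length as = pred_ar L p"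
  shows "pred_int (reduced_product F M) p (map (red_class F M) as) =
           flimsup F (\<lambda>i. pred_int (M i) p (map (\<lambda>a. a i) as))"
proof -
  let ?as = "\<lambda>i. map (\<lambda>a. a i) as" and ?bs = "\<lambda>i. map (\<lambda>A. rep A i) (map (red_class F M) as)"
  have bd: "\<bar>pred_int (M i) p xs\<bar> \<le> max \<bar>pred_lower L p\<bar> \<bar>pred_upper L p\<bar>"
    if "xs \<in> tuples (pred_ar L p) (mdom (M i))" for i xs
  proof -
    have "pred_lower L p \<le> pred_int (M i) p xs" "pred_int (M i) p xs \<le> pred_upper L p"
      using struct[of i] p that by (auto simp: metric_structure_def)
    then show ?thesis by linarith
  qed
  have "flimsup F (\<lambda>i. pred_int (M i) p (?bs i)) = flimsup F (\<lambda>i. pred_int (M i) p (?as i))"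
  proof (rule flimsup_cong[OF proper bd[OF coords_tuples(2)[OF as]] bd[OF coords_tuples(1)[OF as]]])
    fix e :: real assume "e > 0"
    then have "pred_mod L p e > 0"
      using signature p by (simp add: metric_signature_def)
    from reps_close[OF as(1) this]
    show "\<forall>\<^sub>F i in F. \<bar>pred_int (M i) p (?bs i) - pred_int (M i) p (?as i)\<bar> \<le> e"
    proof eventually_elim
      case (elim i)
      have "\<bar>pred_int (M i) p (?as i) - pred_int (M i) p (?bs i)\<bar> \<le> e"
        using struct[of i] p elim \<open>e > 0\<close> coords_tuples[OF as, of i]
        unfolding metric_structure_def by blast
      then show ?case by (simp add: abs_minus_commute)
    qed
  qed
  then show ?thesis
    by (simp add: reduced_product_def)
qed

theorem red_fun:
  assumes f: "f \<in> funs L" and as: "set as \<subseteq> prod_dom M" "length as = fun_ar L f"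
  shows "fun_int (reduced_product F M) f (map (red_class F M) as) =
           red_class F M (\<lambda>i. fun_int (M i) f (map (\<lambda>a. a i) as))"
proof -
  let ?as = "\<lambda>i. map (\<lambda>a. a i) as" and ?bs = "\<lambda>i. map (\<lambda>A. rep A i) (map (red_class F M) as)"
  have mem: "(\<lambda>i. fun_int (M i) f (?as i)) \<in> prod_dom M" "(\<lambda>i. fun_int (M i) f (?bs i)) \<in> prod_dom M"
    unfolding prod_dom_def Pi_iff using struct f coords_tuples[OF as] by (auto simp: metric_structure_def simp del: map_map)
  have "\<forall>\<^sub>F i in F. dst (M i) (fun_int (M i) f (?as i)) (fun_int (M i) f (?bs i)) < e" if "e > 0" for e
  proof -
    have "fun_mod L f (e / 2) > 0"
      using signature f that by (simp add: metric_signature_def)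
    from reps_close[OF as(1) this] show ?thesis
    proof eventually_elim
      case (elim i)
      have "e / 2 > 0" using that by simp
      then have "dst (M i) (fun_int (M i) f (?as i)) (fun_int (M i) f (?bs i)) \<le> e / 2"
        using struct[of i] f elim coords_tuples[OF as, of i]
        unfolding metric_structure_def by blast
      then show ?case using that by linarith
    qed
  qed
  then have "((\<lambda>i. fun_int (M i) f (?as i)), (\<lambda>i. fun_int (M i) f (?bs i))) \<in> red_rel F M"
    using mem by (simp add: red_rel_iff del: map_map)
  then show ?thesis
    using equiv_class_eq[OF equiv_red_rel] by (simp add: reduced_product_def red_class_def o_def)
qed

end


section \<open>The reduced power of the two-element Boolean algebra\<close>

definition agree_rel :: "'i filter \<Rightarrow> ('i set \<times> 'i set) set" where
  "agree_rel F = {(X, Y). \<forall>\<^sub>F i in F. i \<in> X \<longleftrightarrow> i \<in> Y}"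

text \<open>
  The Boolean algebra is presented by its order: the class of \<open>X\<close> is below the class of \<open>Y\<close> iff
  \<open>X \<inter> Y\<close> and \<open>X\<close> have the same class.
\<close>

definition two_power :: "'i filter \<Rightarrow> 'i set set gorder" where
  "two_power F =
     \<lparr> carrier = UNIV // agree_rel F, eq = (=),
       le = (\<lambda>A B. \<exists>X\<in>A. \<exists>Y\<in>B. agree_rel F `` {X \<inter> Y} = A) \<rparr>"

lemma equiv_agree_rel: "equiv UNIV (agree_rel F)"
proof (rule equivI)
  show "trans_on UNIV (agree_rel F)"
  proof (rule trans_onI)
    fix X Y Z assume "(X, Y) \<in> agree_rel F" "(Y, Z) \<in> agree_rel F"
    then have "\<forall>\<^sub>F i in F. i \<in> X \<longleftrightarrow> i \<in> Y" "\<forall>\<^sub>F i in F. i \<in> Y \<longleftrightarrow> i \<in> Z"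
      by (simp_all add: agree_rel_def)
    then have "\<forall>\<^sub>F i in F. i \<in> X \<longleftrightarrow> i \<in> Z"
      by eventually_elim simp
    then show "(X, Z) \<in> agree_rel F"
      by (simp add: agree_rel_def)
  qed
qed (auto simp: refl_on_def sym_on_def agree_rel_def elim: eventually_mono)

lemma two_power_le:
  "agree_rel F `` {X} \<sqsubseteq>\<^bsub>two_power F\<^esub> agree_rel F `` {Y} \<longleftrightarrow> (\<forall>\<^sub>F i in F. i \<in> X \<longrightarrow> i \<in> Y)"
proof
  assume "agree_rel F `` {X} \<sqsubseteq>\<^bsub>two_power F\<^esub> agree_rel F `` {Y}"
  then obtain X' Y' where "(X, X') \<in> agree_rel F" "(Y, Y') \<in> agree_rel F"
      "agree_rel F `` {X' \<inter> Y'} = agree_rel F `` {X}"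
    by (auto simp: two_power_def)
  then have "(X, X') \<in> agree_rel F" "(Y, Y') \<in> agree_rel F" "(X' \<inter> Y', X) \<in> agree_rel F"
    using eq_equiv_class[OF _ equiv_agree_rel] by auto
  then have "\<forall>\<^sub>F i in F. i \<in> X \<longleftrightarrow> i \<in> X'" "\<forall>\<^sub>F i in F. i \<in> Y \<longleftrightarrow> i \<in> Y'"
      "\<forall>\<^sub>F i in F. i \<in> X' \<inter> Y' \<longleftrightarrow> i \<in> X"
    by (auto simp: agree_rel_def)
  then show "\<forall>\<^sub>F i in F. i \<in> X \<longrightarrow> i \<in> Y"
    by eventually_elim auto
next
  assume "\<forall>\<^sub>F i in F. i \<in> X \<longrightarrow> i \<in> Y"
  then have "(X \<inter> Y, X) \<in> agree_rel F"
    by (auto simp: agree_rel_def elim: eventually_mono)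
  then have "agree_rel F `` {X \<inter> Y} = agree_rel F `` {X}"
    by (rule equiv_class_eq[OF equiv_agree_rel])
  moreover have "Z \<in> agree_rel F `` {Z}" for Z :: "'a set"
    by (simp add: agree_rel_def)
  ultimately show "agree_rel F `` {X} \<sqsubseteq>\<^bsub>two_power F\<^esub> agree_rel F `` {Y}"
    unfolding two_power_def by auto
qed

lemma partial_order_two_power: "partial_order (two_power F)"
proof -
  have carrier: "\<exists>X. A = agree_rel F `` {X}" if "A \<in> carrier (two_power F)" for A
    using that by (auto simp: two_power_def elim: quotientE)
  have refl: "A \<sqsubseteq>\<^bsub>two_power F\<^esub> A" if "A \<in> carrier (two_power F)" for A
    using carrier[OF that] by (auto simp: two_power_le)
  have antisym: "A = B" if "A \<sqsubseteq>\<^bsub>two_power F\<^esub> B" "B \<sqsubseteq>\<^bsub>two_power F\<^esub> A"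
    and AB: "A \<in> carrier (two_power F)" "B \<in> carrier (two_power F)" for A B
  proof -
    obtain X Y where XY: "A = agree_rel F `` {X}" "B = agree_rel F `` {Y}"
      using carrier AB by blast
    have "\<forall>\<^sub>F i in F. i \<in> X \<longrightarrow> i \<in> Y" "\<forall>\<^sub>F i in F. i \<in> Y \<longrightarrow> i \<in> X"
      using that(1,2) unfolding XY two_power_le .
    then have "\<forall>\<^sub>F i in F. i \<in> X \<longleftrightarrow> i \<in> Y"
      by eventually_elim blast
    then have "(X, Y) \<in> agree_rel F"
      by (simp add: agree_rel_def)
    then show ?thesis
      using XY equiv_class_eq[OF equiv_agree_rel] by blast
  qed
  have trans: "A \<sqsubseteq>\<^bsub>two_power F\<^esub> C" if "A \<sqsubseteq>\<^bsub>two_power F\<^esub> B" "B \<sqsubseteq>\<^bsub>two_power F\<^esub> C"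
    and ABC: "A \<in> carrier (two_power F)" "B \<in> carrier (two_power F)" "C \<in> carrier (two_power F)" for A B C
  proof -
    obtain X Y Z where XYZ: "A = agree_rel F `` {X}" "B = agree_rel F `` {Y}" "C = agree_rel F `` {Z}"
      using carrier ABC by blast
    have "\<forall>\<^sub>F i in F. i \<in> X \<longrightarrow> i \<in> Y" "\<forall>\<^sub>F i in F. i \<in> Y \<longrightarrow> i \<in> Z"
      using that(1,2) unfolding XYZ two_power_le .
    then have "\<forall>\<^sub>F i in F. i \<in> X \<longrightarrow> i \<in> Z"
      by eventually_elim blast
    then show ?thesis
      unfolding XYZ two_power_le .
  qed
  have eq: "(.=\<^bsub>two_power F\<^esub>) = (=)"
    by (simp add: two_power_def)
  show ?thesis
    by unfold_locales (use refl antisym trans in \<open>simp_all add: eq; blast\<close>)+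
qed

lemma two_power_least:
  "least (two_power F) (agree_rel F `` {X}) (carrier (two_power F)) \<longleftrightarrow> (\<forall>\<^sub>F i in F. i \<notin> X)"
proof -
  have "carrier (two_power F) = range (\<lambda>Y. agree_rel F `` {Y})"
    by (auto simp: two_power_def quotient_def)
  then have "least (two_power F) (agree_rel F `` {X}) (carrier (two_power F)) \<longleftrightarrow>
      (\<forall>Y. \<forall>\<^sub>F i in F. i \<in> X \<longrightarrow> i \<in> Y)"
    by (simp add: least_def two_power_le)
  also have "\<dots> \<longleftrightarrow> (\<forall>\<^sub>F i in F. i \<notin> X)"
    by (auto elim: eventually_mono dest: spec[of _ "{}"])
  finally show ?thesis .
qed

definition atom :: "'b gorder \<Rightarrow> 'b \<Rightarrow> bool" where
  "atom B a \<longleftrightarrow> a \<in> carrier B \<and> \<not> least B a (carrier B) \<and>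
     (\<forall>b\<in>carrier B. b \<sqsubset>\<^bsub>B\<^esub> a \<longrightarrow> least B b (carrier B))"

definition atomless :: "'b gorder \<Rightarrow> bool" where
  "atomless B \<longleftrightarrow> (\<nexists>a. atom B a)"

end

theory Submission
  imports Defs
begin

text \<open>
  Palyutin formulas satisfy a Los theorem for reduced products: the value in the reduced product
  is the limit superior of the values in the factors, so \<open>\<phi> < s\<close> holds in the reduced product only
  if it holds on a set in the filter, whereas \<open>D \<psi> < s\<close> with \<open>D\<close> nonincreasing holds as soon as
  \<open>\<psi>\<close> exceeds some \<open>t\<close> with \<open>D t < s\<close> on a set that is merely positive, that is, whose complement
  is not in the filter. Given separate witnesses for the pairs \<open>\<phi>, D\<^sub>j \<psi>\<^sub>j\<close>, atomlessness
  provides pairwise disjoint positive subsets of the sets where \<open>\<psi>\<^sub>j\<close> exceeds \<open>t\<^sub>j\<close>, and gluing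
  the witnesses along these subsets yields one witness for all pairs.
\<close>

section \<open>Limit superior of a bounded real family along a filter\<close>

lemma flimsup_bounded:
  assumes "F \<noteq> bot" "\<And>i. \<bar>u i\<bar> \<le> B"
  shows "\<bar>flimsup F u\<bar> \<le> B"
proof -
  have "flimsup F u \<le> B"
    using assms by (intro flimsup_le[OF assms]) (simp add: abs_le_iff)
  moreover have "- B \<le> flimsup F u"
  proof (rule flimsup_ge[OF assms])
    show "- B \<le> u i" for i
      using assms(2)[of i] by linarith
  qed
  ultimately show ?thesis by linarith
qed

lemma flimsup_greater:
  assumes "F \<noteq> bot" "\<And>i. \<bar>u i\<bar> \<le> B" "c < flimsup F u"
  shows "\<exists>\<^sub>F i in F. c < u i"
proof (rule ccontr)
  assume "\<not> (\<exists>\<^sub>F i in F. c < u i)"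
  then have "\<forall>\<^sub>F i in F. u i \<le> c"
    by (simp add: not_frequently not_less)
  from flimsup_le[OF assms(1,2) this] show False
    using assms(3) by simp
qed

lemma le_flimsup:
  assumes "F \<noteq> bot" "\<And>i. \<bar>u i\<bar> \<le> B" "\<exists>\<^sub>F i in F. c \<le> u i"
  shows "c \<le> flimsup F u"
proof (rule ccontr)
  assume "\<not> c \<le> flimsup F u"
  then have "\<forall>\<^sub>F i in F. u i < c"
    using flimsup_less[OF assms(1,2)] by simp
  then show False
    using assms(3) by (simp add: frequently_def not_le)
qed

text \<open>The two tests are asymmetric in the way a limit superior is: being above
  \<open>l\<close> must be met on a set in the filter, being below \<open>l\<close> only on a
  positive set. The connective and quantifier cases below all come down to these two tests.\<close>

lemma flimsup_eqI:
  assumes "F \<noteq> bot" "\<And>i. \<bar>u i\<bar> \<le> B"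
    and upper: "\<And>c. l < c \<Longrightarrow> \<forall>\<^sub>F i in F. u i \<le> c"
    and lower: "\<And>c. c < l \<Longrightarrow> \<exists>\<^sub>F i in F. c \<le> u i"
  shows "flimsup F u = l"
proof (rule antisym)
  show "flimsup F u \<le> l"
    using flimsup_le[OF assms(1,2) upper] by (rule dense_ge)
  show "l \<le> flimsup F u"
    using le_flimsup[OF assms(1,2) lower] by (rule dense_le)
qed

text \<open>Strict bounds on \<open>C\<close> survive a small move of the argument to either side.
  The moved point is strictly separated from a limit superior, as \<open>flimsup_less\<close> and
  \<open>flimsup_greater\<close> demand.\<close>

lemma continuous_real_neighbours:
  fixes C :: "real \<Rightarrow> real"
  assumes "unary_connective C"
  shows "C x < c \<Longrightarrow> \<exists>t<x. C t < c" and "C x < c \<Longrightarrow> \<exists>t>x. C t < c"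
    and "c < C x \<Longrightarrow> \<exists>t<x. c < C t" and "c < C x \<Longrightarrow> \<exists>t>x. c < C t"
proof -
  have "C \<midarrow>x\<rightarrow> C x"
    using assms by (simp add: continuous_on_def)
  then have left: "(C \<longlongrightarrow> C x) (at_left x)" and right: "(C \<longlongrightarrow> C x) (at_right x)"
    by (auto intro: tendsto_within_subset)
  have *: "\<exists>t<x. P t" if "eventually P (at_left x)" for P
    using that dense unfolding eventually_at_left_field by meson
  have **: "\<exists>t>x. P t" if "eventually P (at_right x)" for P
    using that dense unfolding eventually_at_right_field by meson
  show "C x < c \<Longrightarrow> \<exists>t<x. C t < c" by (intro * order_tendstoD[OF left])
  show "C x < c \<Longrightarrow> \<exists>t>x. C t < c" by (intro ** order_tendstoD[OF right])
  show "c < C x \<Longrightarrow> \<exists>t<x. c < C t" by (intro * order_tendstoD[OF left])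
  show "c < C x \<Longrightarrow> \<exists>t>x. c < C t" by (intro ** order_tendstoD[OF right])
qed

text \<open>Upper and lower thresholds pass through a nondecreasing map unchanged in direction. A
  nonincreasing map would instead produce a limit inferior, which is why clause (5) of the Palyutin
  formulas needs an argument of its own.\<close>

lemma flimsup_mono_comp:
  assumes "F \<noteq> bot" and u: "\<And>i. \<bar>u i\<bar> \<le> B" and Cu: "\<And>i. \<bar>C (u i)\<bar> \<le> B'"
    and C: "unary_connective C" "mono C"
  shows "flimsup F (\<lambda>i. C (u i)) = C (flimsup F u)"
proof (rule flimsup_eqI[OF assms(1) Cu])
  fix c assume "C (flimsup F u) < c"
  then obtain t where t: "flimsup F u < t" "C t < c"
    using continuous_real_neighbours[OF C(1)] by blast
  have "\<forall>\<^sub>F i in F. u i < t"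
    by (rule flimsup_less[OF assms(1) u t(1)])
  then show "\<forall>\<^sub>F i in F. C (u i) \<le> c"
  proof eventually_elim
    case (elim i)
    then show ?case using monoD[OF C(2), of "u i" t] t(2) by linarith
  qed
next
  fix c assume "c < C (flimsup F u)"
  then obtain t where t: "t < flimsup F u" "c < C t"
    using continuous_real_neighbours[OF C(1)] by blast
  have "\<exists>\<^sub>F i in F. t < u i"
    by (rule flimsup_greater[OF assms(1) u t(1)])
  then show "\<exists>\<^sub>F i in F. c \<le> C (u i)"
  proof (rule frequently_elim1)
    fix i assume "t < u i"
    then show "c \<le> C (u i)" using monoD[OF C(2), of t "u i"] t(2) by linarith
  qed
qed

text \<open>Two sets in the filter intersect in the filter, and one positive set is enough for the
  maximum to be large. The analogue for \<open>min\<close> fails in general, since two positive sets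
  may be disjoint.\<close>

lemma flimsup_max:
  assumes "F \<noteq> bot" and u: "\<And>i. \<bar>u i\<bar> \<le> B" and v: "\<And>i. \<bar>v i\<bar> \<le> B'"
  shows "flimsup F (\<lambda>i. max (u i) (v i)) = max (flimsup F u) (flimsup F v)"
proof (rule flimsup_eqI[OF assms(1)])
  show "\<bar>max (u i) (v i)\<bar> \<le> max B B'" for i
    using u[of i] v[of i] by linarith
next
  fix c assume "max (flimsup F u) (flimsup F v) < c"
  then have "\<forall>\<^sub>F i in F. u i < c" "\<forall>\<^sub>F i in F. v i < c"
    using flimsup_less[OF assms(1) u] flimsup_less[OF assms(1) v] by auto
  then show "\<forall>\<^sub>F i in F. max (u i) (v i) \<le> c"
    by eventually_elim simp
next
  fix c assume "c < max (flimsup F u) (flimsup F v)"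
  then have "(\<exists>\<^sub>F i in F. c < u i) \<or> (\<exists>\<^sub>F i in F. c < v i)"
    using flimsup_greater[OF assms(1) u] flimsup_greater[OF assms(1) v] by (auto simp: less_max_iff_disj)
  then show "\<exists>\<^sub>F i in F. c \<le> max (u i) (v i)"
    by (auto elim: frequently_elim1)
qed

section \<open>Values of connectives and of iterated quantifiers\<close>

lemma val_UnF [simp]: "val M v (UnF C \<phi>) = C (val M v \<phi>)"
  by (simp add: UnF_def)

lemma val_ConstF [simp]: "val M v (ConstF r) = r"
  by (simp add: ConstF_def)

lemma val_MaxF:
  assumes "\<phi>s \<noteq> []"
  shows "val M v (MaxF \<phi>s) = Max (val M v ` set \<phi>s)"
proof -
  have "val M v (MaxF \<phi>s) = (MAX k\<in>{..<length \<phi>s}. val M v (\<phi>s ! k))"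
    by (simp add: MaxF_def cong: image_cong_simp)
  also have "(\<lambda>k. val M v (\<phi>s ! k)) ` {..<length \<phi>s} = val M v ` set \<phi>s"
    by (auto simp: set_conv_nth)
  finally show ?thesis .
qed

lemma val_MinF:
  assumes "\<phi>s \<noteq> []"
  shows "val M v (MinF \<phi>s) = Min (val M v ` set \<phi>s)"
proof -
  have "val M v (MinF \<phi>s) = (MIN k\<in>{..<length \<phi>s}. val M v (\<phi>s ! k))"
    by (simp add: MinF_def cong: image_cong_simp)
  also have "(\<lambda>k. val M v (\<phi>s ! k)) ` {..<length \<phi>s} = val M v ` set \<phi>s"
    by (auto simp: set_conv_nth)
  finally show ?thesis .
qed

lemma val_MaxF2 [simp]: "val M v (MaxF [\<phi>, \<psi>]) = max (val M v \<phi>) (val M v \<psi>)"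
  by (simp add: val_MaxF)

lemma val_MinF3 [simp]:
  "val M v (MinF [\<phi>, \<psi>, \<theta>]) = min (val M v \<phi>) (min (val M v \<psi>) (val M v \<theta>))"
  by (simp add: val_MinF)

lemma val_DiffF [simp]: "val M v (DiffF \<phi> \<psi>) = val M v \<phi> - val M v \<psi>"
  by (simp add: DiffF_def)

lemma val_term_in_mdom:
  assumes "metric_structure L M" "range v \<subseteq> mdom M" "is_term L t"
  shows "val_term M v t \<in> mdom M"
  using assms(3)
proof (induction t)
  case (Var x)
  then show ?case using assms(2) by auto
next
  case (App f ts)
  then have "map (val_term M v) ts \<in> tuples (fun_ar L f) (mdom M)"
    by (auto simp: tuples_def)
  then show ?case
    using assms(1) App.prems by (auto simp: metric_structure_def)
qed

lemma range_fun_upd_subset: "range v \<subseteq> A \<Longrightarrow> a \<in> A \<Longrightarrow> range (v(x := a)) \<subseteq> A"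
  by auto

lemma val_SupsF_le:
  assumes "mdom M \<noteq> {}" "\<And>v. range v \<subseteq> mdom M \<Longrightarrow> val M v \<theta> \<le> c" "range v \<subseteq> mdom M"
  shows "val M v (SupsF xs \<theta>) \<le> c"
  using assms(3)
proof (induction xs arbitrary: v)
  case Nil
  then show ?case using assms(2) by simp
next
  case (Cons x xs)
  then show ?case
    using assms(1) by (simp del: fun_upd_apply) (intro cSUP_least Cons.IH range_fun_upd_subset)
qed

lemma val_InfsF_ge:
  assumes "mdom M \<noteq> {}" "\<And>v. range v \<subseteq> mdom M \<Longrightarrow> c \<le> val M v \<theta>" "range v \<subseteq> mdom M"
  shows "c \<le> val M v (InfsF xs \<theta>)"
  using assms(3)
proof (induction xs arbitrary: v)
  case Nil
  then show ?case using assms(2) by simp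
next
  case (Cons x xs)
  then show ?case
    using assms(1) by (simp del: fun_upd_apply) (intro cINF_greatest Cons.IH range_fun_upd_subset)
qed

text \<open>The assignment \<open>v\<close> is turned into \<open>v'\<close> one quantified variable
  at a time. The lower bound \<open>c\<close> makes each real infimum one over a set bounded below,
  so that it lies below its members.\<close>

lemma val_InfsF_le:
  assumes bound: "\<And>v. range v \<subseteq> mdom M \<Longrightarrow> c \<le> val M v \<theta>"
    and "range v \<subseteq> mdom M" "range v' \<subseteq> mdom M" "\<And>x. x \<notin> set xs \<Longrightarrow> v' x = v x"
  shows "val M v (InfsF xs \<theta>) \<le> val M v' \<theta>"
  using assms(2,4)
proof (induction xs arbitrary: v)
  case Nil
  then have "v' = v" by auto
  then show ?case by simp
next
  case (Cons x xs)
  have x: "v' x \<in> mdom M" using assms(3) by auto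
  then have ne: "mdom M \<noteq> {}" by auto
  have "bdd_below ((\<lambda>a. val M (v(x := a)) (InfsF xs \<theta>)) ` mdom M)"
    using Cons.prems(1) by (intro bdd_belowI2[where m = c] val_InfsF_ge[OF ne bound] range_fun_upd_subset)
  then have "val M v (InfsF (x # xs) \<theta>) \<le> val M (v(x := v' x)) (InfsF xs \<theta>)"
    unfolding foldr.simps o_apply val.simps(5) using x by (rule cINF_lower)
  also have "\<dots> \<le> val M v' \<theta>"
    using Cons.prems x by (intro Cons.IH range_fun_upd_subset) auto
  finally show ?case .
qed

text \<open>The infima need not be attained, but a strict upper bound is passed by some element at
  each quantifier.\<close>

lemma val_InfsF_lessD:
  assumes "mdom M \<noteq> {}" "range v \<subseteq> mdom M" "val M v (InfsF xs \<theta>) < c"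
  shows "\<exists>v'. range v' \<subseteq> mdom M \<and> (\<forall>x. x \<notin> set xs \<longrightarrow> v' x = v x) \<and> val M v' \<theta> < c"
  using assms(2,3)
proof (induction xs arbitrary: v)
  case Nil
  then show ?case by auto
next
  case (Cons x xs)
  then obtain a where a: "a \<in> mdom M" "val M (v(x := a)) (InfsF xs \<theta>) < c"
    using cInf_lessD[of "(\<lambda>a. val M (v(x := a)) (InfsF xs \<theta>)) ` mdom M" c] assms(1) by auto
  obtain v' where v': "range v' \<subseteq> mdom M" "\<forall>y. y \<notin> set xs \<longrightarrow> v' y = (v(x := a)) y" "val M v' \<theta> < c"
    using Cons.IH[OF range_fun_upd_subset[OF Cons.prems(1) a(1)] a(2)] by blast
  then have "\<forall>y. y \<notin> set (x # xs) \<longrightarrow> v' y = v y" by auto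
  then show ?case using v' by blast
qed

section \<open>Splitting positive sets\<close>

text \<open>The sets are treated one after another. If \<open>J n\<close> meets an earlier
  \<open>K k\<close> in a positive set, that intersection is split between the two; otherwise
  \<open>J n\<close> stays positive after all earlier sets are removed.\<close>

lemma disjoint_frequent_refinement:
  assumes split: "\<And>X. \<exists>\<^sub>F i in F. i \<in> X \<Longrightarrow> \<exists>Y\<subseteq>X. (\<exists>\<^sub>F i in F. i \<in> Y) \<and> (\<exists>\<^sub>F i in F. i \<in> X - Y)"
    and "\<And>j. j < n \<Longrightarrow> \<exists>\<^sub>F i in F. i \<in> J j"
  shows "\<exists>K. (\<forall>j<(n::nat). K j \<subseteq> J j \<and> (\<exists>\<^sub>F i in F. i \<in> K j)) \<and> disjoint_family_on K {..<n}"
  using assms(2)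
proof (induction n)
  case 0
  then show ?case by (auto simp: disjoint_family_on_def)
next
  case (Suc n)
  then obtain K where K: "\<And>j. j < n \<Longrightarrow> K j \<subseteq> J j" "\<And>j. j < n \<Longrightarrow> \<exists>\<^sub>F i in F. i \<in> K j"
    and disj: "\<And>j k. j < n \<Longrightarrow> k < n \<Longrightarrow> j \<noteq> k \<Longrightarrow> K j \<inter> K k = {}"
    unfolding disjoint_family_on_def by (metis lessThan_iff less_Suc_eq)
  show ?case
  proof (cases "\<exists>k<n. \<exists>\<^sub>F i in F. i \<in> J n \<inter> K k")
    case True
    then obtain k where k: "k < n" "\<exists>\<^sub>F i in F. i \<in> J n \<inter> K k" by blast
    obtain Y where Y: "Y \<subseteq> J n \<inter> K k" "\<exists>\<^sub>F i in F. i \<in> Y" "\<exists>\<^sub>F i in F. i \<in> J n \<inter> K k - Y"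
      using split[OF k(2)] by blast
    \<comment> \<open>Only \<open>K k\<close> shrinks, and both halves of the split are positive.
      The new set \<open>Y\<close> lies inside the old \<open>K k\<close>, hence is disjoint from
      all the other sets.\<close>
    let ?K = "K(k := J n \<inter> K k - Y, n := Y)"
    have "?K j \<subseteq> J j \<and> (\<exists>\<^sub>F i in F. i \<in> ?K j)" if "j < Suc n" for j
      using that k(1) K[of j] K(1)[of k] Y by (cases "j = n"; cases "j = k") auto
    moreover have "disjoint_family_on ?K {..<Suc n}"
      unfolding disjoint_family_on_def
    proof (intro ballI impI)
      fix j l assume jl: "j \<in> {..<Suc n}" "l \<in> {..<Suc n}" "j \<noteq> l"
      have sub: "?K m \<subseteq> K m" if "m < n" for m
        using that by auto
      have last: "Y \<inter> ?K m = {}" if "m < n" for m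
        using that disj[of k m] k(1) Y(1) by (cases "m = k") auto
      show "?K j \<inter> ?K l = {}"
      proof (cases "j = n \<or> l = n")
        case True
        then show ?thesis using jl last[of j] last[of l] by auto
      next
        case False
        then have "j < n" "l < n" using jl by auto
        then show ?thesis using sub[of j] sub[of l] disj[of j l] jl(3) by blast
      qed
    qed
    ultimately show ?thesis by blast
  next
    case False
    let ?Y = "J n - (\<Union>k<n. K k)"
    let ?K = "K(n := ?Y)"
    \<comment> \<open>Each overlap is null and there are finitely many, so one set in the filter
      avoids them all.\<close>
    have "\<forall>\<^sub>F i in F. \<forall>k\<in>{..<n}. i \<notin> J n \<inter> K k"
      using False by (intro eventually_ball_finite) (auto simp: not_frequently)
    moreover have "\<exists>\<^sub>F i in F. i \<in> J n"
      using Suc.prems by blast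
    ultimately have "\<exists>\<^sub>F i in F. (\<forall>k\<in>{..<n}. i \<notin> J n \<inter> K k) \<and> i \<in> J n"
      by (intro frequently_eventually_conj)
    then have "\<exists>\<^sub>F i in F. i \<in> ?Y"
      by (rule frequently_elim1) blast
    then have "?K j \<subseteq> J j \<and> (\<exists>\<^sub>F i in F. i \<in> ?K j)" if "j < Suc n" for j
      using that K[of j] by (cases "j = n") auto
    moreover have "j = k" if "i \<in> K j" "i \<in> K k" "j < n" "k < n" for i j k
      using that disj[of j k] by blast
    then have "disjoint_family_on ?K {..<Suc n}"
      by (auto simp: disjoint_family_on_def less_Suc_eq)
    ultimately show ?thesis by blast
  qed
qed

text \<open>Positive sets are exactly those with nonzero class. As the class of \<open>X\<close> is
  not an atom, a nonzero class of some \<open>Z\<close> lies strictly below it, and \<open>Z\<close>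
  cuts \<open>X\<close> into two positive pieces.\<close>

lemma atomless_two_power_split:
  assumes "atomless (two_power F)" "\<exists>\<^sub>F i in F. i \<in> X"
  shows "\<exists>Y\<subseteq>X. (\<exists>\<^sub>F i in F. i \<in> Y) \<and> (\<exists>\<^sub>F i in F. i \<in> X - Y)"
proof -
  let ?B = "two_power F"
  have carrier: "carrier ?B = range (\<lambda>X. agree_rel F `` {X})"
    by (auto simp: two_power_def quotient_def)
  have eq: "(.=\<^bsub>?B\<^esub>) = (=)"
    by (simp add: two_power_def)
  have "\<not> atom ?B (agree_rel F `` {X})"
    using assms(1) by (simp add: atomless_def)
  moreover have "\<not> least ?B (agree_rel F `` {X}) (carrier ?B)"
    using assms(2) by (simp only: two_power_least not_eventually not_not)
  ultimately obtain b where b: "b \<in> carrier ?B" "b \<sqsubset>\<^bsub>?B\<^esub> agree_rel F `` {X}" "\<not> least ?B b (carrier ?B)"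
    unfolding atom_def using carrier by blast
  then obtain Z where "b = agree_rel F `` {Z}"
    using carrier by blast
  then have Z: "agree_rel F `` {Z} \<sqsubset>\<^bsub>?B\<^esub> agree_rel F `` {X}" "\<exists>\<^sub>F i in F. i \<in> Z"
    using b by (simp_all only: two_power_least not_eventually not_not)
  then have le: "\<forall>\<^sub>F i in F. i \<in> Z \<longrightarrow> i \<in> X"
    and ne: "agree_rel F `` {Z} \<noteq> agree_rel F `` {X}"
    by (auto simp: lless_def two_power_le eq)
  have "\<exists>\<^sub>F i in F. i \<in> X - Z"
  proof (rule ccontr)
    assume "\<not> (\<exists>\<^sub>F i in F. i \<in> X - Z)"
    then have "\<forall>\<^sub>F i in F. i \<notin> X - Z"
      by (simp add: not_frequently)
    with le have "\<forall>\<^sub>F i in F. i \<in> Z \<longleftrightarrow> i \<in> X"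
      by eventually_elim blast
    then have "(Z, X) \<in> agree_rel F"
      by (simp add: agree_rel_def)
    then show False
      using ne equiv_class_eq[OF equiv_agree_rel] by blast
  qed
  \<comment> \<open>\<open>Z\<close> is contained in \<open>X\<close> only modulo the filter;
    \<open>X \<inter> Z\<close> is the representative that is a true subset.\<close>
  then have "\<exists>\<^sub>F i in F. i \<in> X - X \<inter> Z"
    by (rule frequently_elim1) blast
  moreover have "\<exists>\<^sub>F i in F. i \<in> X \<inter> Z"
    using frequently_eventually_conj[OF Z(2) le] by (rule frequently_elim1) blast
  ultimately show ?thesis by blast
qed

text \<open>Here the positive sets are the infinite ones, and an infinite set contains two disjoint
  infinite sets. This gives the splitting property directly, without the Boolean algebra.\<close>

lemma cofinite_split:
  assumes "\<exists>\<^sub>F i in cofinite. i \<in> X"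
  shows "\<exists>Y\<subseteq>X. (\<exists>\<^sub>F i in cofinite. i \<in> Y) \<and> (\<exists>\<^sub>F i in cofinite. i \<in> X - Y)"
proof -
  have freq: "(\<exists>\<^sub>F i in cofinite. i \<in> Z) \<longleftrightarrow> infinite Z" for Z :: "'a set"
    by (simp add: frequently_cofinite)
  obtain Y Z where "Y \<subseteq> X" "Z \<subseteq> X" "infinite Y" "infinite Z" "Y \<inter> Z = {}"
    using infinite_split assms unfolding freq by metis
  moreover from this have "infinite (X - Y)"
    by (intro infinite_super[of Z "X - Y"]) auto
  ultimately show ?thesis unfolding freq by blast
qed

section \<open>Assignments and terms in the reduced product\<close>

context structure_family
begin

abbreviation prodF :: "('f, 'p, ('i \<Rightarrow> 'a) set) mstr" where
  "prodF \<equiv> reduced_product F M"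

text \<open>A family \<open>w\<close> of product elements plays two parts: \<open>cls w\<close> is
  an assignment into the reduced product, and \<open>coord w i\<close> is the matching assignment
  into the factor at \<open>i\<close>.\<close>

abbreviation cls :: "(nat \<Rightarrow> 'i \<Rightarrow> 'a) \<Rightarrow> nat \<Rightarrow> ('i \<Rightarrow> 'a) set" where
  "cls w \<equiv> \<lambda>x. red_class F M (w x)"

abbreviation coord :: "(nat \<Rightarrow> 'i \<Rightarrow> 'a) \<Rightarrow> 'i \<Rightarrow> nat \<Rightarrow> 'a" where
  "coord w i \<equiv> \<lambda>x. w x i"

lemma mdom_prodF: "mdom prodF = red_class F M ` prod_dom M"
  by (auto simp: reduced_product_def red_class_def quotient_def)

lemma mdom_nonempty: "mdom (M i) \<noteq> {}"
  using struct[of i] by (simp add: metric_structure_def)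

lemma prod_dom_nonempty: "prod_dom M \<noteq> {}"
  using mdom_nonempty by (simp add: prod_dom_def Pi_eq_empty)

lemma mdom_prodF_nonempty: "mdom prodF \<noteq> {}"
  using prod_dom_nonempty by (simp add: mdom_prodF)

text \<open>Consequently every assignment \<open>v\<close> into the reduced product has the form
  \<open>cls w\<close>, with \<open>w x = rep (v x)\<close>.\<close>

lemma red_class_rep:
  assumes "A \<in> mdom prodF"
  shows "rep A \<in> prod_dom M" "red_class F M (rep A) = A"
proof -
  obtain a where a: "a \<in> prod_dom M" "A = red_class F M a"
    using assms by (auto simp: mdom_prodF)
  then have rel: "(a, rep A) \<in> red_rel F M"
    using rep_red_class by simp
  then show "rep A \<in> prod_dom M"
    by (simp add: red_rel_def)
  show "red_class F M (rep A) = A"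
    unfolding a(2)[unfolded red_class_def] red_class_def
    using equiv_class_eq[OF equiv_red_rel rel] a(2) by (simp add: red_class_def)
qed

lemma range_coord: "range w \<subseteq> prod_dom M \<Longrightarrow> range (coord w i) \<subseteq> mdom (M i)"
  by (auto simp: prod_dom_def Pi_iff)

lemma cls_upd: "(cls w)(x := red_class F M b) = cls (w(x := b))"
  by (simp add: fun_eq_iff)

lemma coord_upd: "(coord w i)(x := b i) = coord (w(x := b)) i"
  by (simp add: fun_eq_iff)

lemma val_term_prodF:
  assumes "range w \<subseteq> prod_dom M" "is_term L t"
  shows "val_term prodF (cls w) t = red_class F M (\<lambda>i. val_term (M i) (coord w i) t)"
  using assms(2)
proof (induction t)
  case (App f ts)
  let ?as = "map (\<lambda>t i. val_term (M i) (coord w i) t) ts"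
  have args: "map (val_term prodF (cls w)) ts = map (red_class F M) ?as"
    using App by simp
  have coords: "map (\<lambda>a. a i) ?as = map (val_term (M i) (coord w i)) ts" for i
    by simp
  have "set ?as \<subseteq> prod_dom M"
    using App.prems val_term_in_mdom[OF struct range_coord[OF assms(1)]] by (auto simp: prod_dom_def)
  then show ?case
    using red_fun[of f ?as] App.prems by (simp add: args coords del: map_map)
qed simp

section \<open>Bounds uniform over all factors\<close>

text \<open>One bound has to serve all indices: the \<open>flimsup\<close> lemmas ask for it, and it
  also legitimizes the real suprema and infima in each factor.\<close>

definition uniformly_bounded :: "('f, 'p) fm \<Rightarrow> bool" where
  "uniformly_bounded \<phi> \<longleftrightarrow>
     (\<exists>B. \<forall>i v. range v \<subseteq> mdom (M i) \<longrightarrow> \<bar>val (M i) v \<phi>\<bar> \<le> B)"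

text \<open>The Los property. Parameters are given by representatives \<open>w\<close>, so that the
  same data can be evaluated in every factor.\<close>

definition limsup_valued :: "('f, 'p) fm \<Rightarrow> bool" where
  "limsup_valued \<phi> \<longleftrightarrow>
     (\<forall>w. range w \<subseteq> prod_dom M \<longrightarrow>
        val prodF (cls w) \<phi> = flimsup F (\<lambda>i. val (M i) (coord w i) \<phi>))"

lemma uniformly_boundedI:
  "(\<And>i v. range v \<subseteq> mdom (M i) \<Longrightarrow> \<bar>val (M i) v \<phi>\<bar> \<le> B) \<Longrightarrow> uniformly_bounded \<phi>"
  by (auto simp: uniformly_bounded_def)

lemma uniformly_boundedE:
  assumes "uniformly_bounded \<phi>"
  obtains B where "\<And>i v. range v \<subseteq> mdom (M i) \<Longrightarrow> \<bar>val (M i) v \<phi>\<bar> \<le> B"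
  using assms by (auto simp: uniformly_bounded_def)

text \<open>A monotone map sends the interval from \<open>- B\<close> to \<open>B\<close> between
  its two endpoint values.\<close>

lemma uniformly_bounded_UnF:
  assumes "uniformly_bounded \<phi>" "mono C \<or> antimono C"
  shows "uniformly_bounded (UnF C \<phi>)"
proof -
  obtain B where B: "\<And>i v. range v \<subseteq> mdom (M i) \<Longrightarrow> \<bar>val (M i) v \<phi>\<bar> \<le> B"
    using assms(1) by (rule uniformly_boundedE) blast
  show ?thesis
  proof (rule uniformly_boundedI)
    fix i and v :: "nat \<Rightarrow> 'a" assume "range v \<subseteq> mdom (M i)"
    from B[OF this] have "- B \<le> val (M i) v \<phi>" "val (M i) v \<phi> \<le> B"
      by linarith+
    with assms(2) show "\<bar>val (M i) v (UnF C \<phi>)\<bar> \<le> max \<bar>C B\<bar> \<bar>C (- B)\<bar>"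
      by (force dest: monoD antimonoD simp: abs_le_iff)
  qed
qed

lemma uniformly_bounded_MaxF2:
  assumes "uniformly_bounded \<phi>" "uniformly_bounded \<psi>"
  shows "uniformly_bounded (MaxF [\<phi>, \<psi>])"
proof -
  obtain B where B: "\<And>i v. range v \<subseteq> mdom (M i) \<Longrightarrow> \<bar>val (M i) v \<phi>\<bar> \<le> B"
    using assms(1) by (rule uniformly_boundedE) blast
  obtain B' where B': "\<And>i v. range v \<subseteq> mdom (M i) \<Longrightarrow> \<bar>val (M i) v \<psi>\<bar> \<le> B'"
    using assms(2) by (rule uniformly_boundedE) blast
  show ?thesis
  proof (rule uniformly_boundedI)
    fix i and v :: "nat \<Rightarrow> 'a" assume v: "range v \<subseteq> mdom (M i)"
    show "\<bar>val (M i) v (MaxF [\<phi>, \<psi>])\<bar> \<le> max B B'"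
      unfolding val_MaxF2 using B[OF v] B'[OF v] by linarith
  qed
qed

lemma uniformly_bounded_MinF3:
  assumes "uniformly_bounded \<phi>" "uniformly_bounded \<psi>"
  shows "uniformly_bounded (MinF [\<phi>, ConstF r, \<psi>])"
proof -
  obtain B where B: "\<And>i v. range v \<subseteq> mdom (M i) \<Longrightarrow> \<bar>val (M i) v \<phi>\<bar> \<le> B"
    using assms(1) by (rule uniformly_boundedE) blast
  obtain B' where B': "\<And>i v. range v \<subseteq> mdom (M i) \<Longrightarrow> \<bar>val (M i) v \<psi>\<bar> \<le> B'"
    using assms(2) by (rule uniformly_boundedE) blast
  show ?thesis
  proof (rule uniformly_boundedI)
    fix i and v :: "nat \<Rightarrow> 'a" assume v: "range v \<subseteq> mdom (M i)"
    show "\<bar>val (M i) v (MinF [\<phi>, ConstF r, \<psi>])\<bar> \<le> max B (max \<bar>r\<bar> B')"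
      unfolding val_MinF3 val_ConstF using B[OF v] B'[OF v] by linarith
  qed
qed

lemma uniformly_bounded_quantifiers:
  assumes "uniformly_bounded \<phi>"
  shows "uniformly_bounded (InfF x \<phi>)" "uniformly_bounded (SupF x \<phi>)"
proof -
  obtain B where B: "\<And>i v. range v \<subseteq> mdom (M i) \<Longrightarrow> \<bar>val (M i) v \<phi>\<bar> \<le> B"
    using assms(1) by (rule uniformly_boundedE) blast
  have upd: "- B \<le> val (M i) (v(x := a)) \<phi>" "val (M i) (v(x := a)) \<phi> \<le> B"
    if "range v \<subseteq> mdom (M i)" "a \<in> mdom (M i)" for i v a
    using B[OF range_fun_upd_subset[OF that, of x]] by linarith+
  show "uniformly_bounded (InfF x \<phi>)"
  proof (rule uniformly_boundedI)
    fix i and v :: "nat \<Rightarrow> 'a" assume v: "range v \<subseteq> mdom (M i)"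
    show "\<bar>val (M i) v (InfF x \<phi>)\<bar> \<le> B"
      unfolding val.simps using upd[OF v] mdom_nonempty
      by (intro cInf_abs_ge) (auto simp: abs_le_iff minus_le_iff)
  qed
  show "uniformly_bounded (SupF x \<phi>)"
  proof (rule uniformly_boundedI)
    fix i and v :: "nat \<Rightarrow> 'a" assume v: "range v \<subseteq> mdom (M i)"
    show "\<bar>val (M i) v (SupF x \<phi>)\<bar> \<le> B"
      unfolding val.simps using upd[OF v] mdom_nonempty
      by (intro cSup_abs_le) (auto simp: abs_le_iff minus_le_iff)
  qed
qed


lemma uniformly_bounded_bdd:
  assumes "uniformly_bounded \<phi>" "range v \<subseteq> mdom (M i)"
  shows "bdd_below ((\<lambda>a. val (M i) (v(x := a)) \<phi>) ` mdom (M i))"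
    and "bdd_above ((\<lambda>a. val (M i) (v(x := a)) \<phi>) ` mdom (M i))"
proof -
  obtain B where B: "\<And>i v. range v \<subseteq> mdom (M i) \<Longrightarrow> \<bar>val (M i) v \<phi>\<bar> \<le> B"
    using assms(1) by (rule uniformly_boundedE) blast
  have *: "- B \<le> val (M i) (v(x := a)) \<phi>" "val (M i) (v(x := a)) \<phi> \<le> B" if "a \<in> mdom (M i)" for a
    using B[OF range_fun_upd_subset[OF assms(2) that, of x]] by linarith+
  show "bdd_below ((\<lambda>a. val (M i) (v(x := a)) \<phi>) ` mdom (M i))"
    using *(1) by (rule bdd_belowI2)
  show "bdd_above ((\<lambda>a. val (M i) (v(x := a)) \<phi>) ` mdom (M i))"
    using *(2) by (rule bdd_aboveI2)
qed

lemma uniformly_bounded_DistF: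
  assumes "is_term L s" "is_term L t"
  shows "uniformly_bounded (DistF s t)"
proof (rule uniformly_boundedI)
  fix i and v :: "nat \<Rightarrow> 'a" assume "range v \<subseteq> mdom (M i)"
  then have "val_term (M i) v s \<in> mdom (M i)" "val_term (M i) v t \<in> mdom (M i)"
    using val_term_in_mdom[OF struct] assms by blast+
  then have "dst (M i) (val_term (M i) v s) (val_term (M i) v t) \<le> diam_bound L"
    using struct[of i] by (simp add: metric_structure_def)
  then show "\<bar>val (M i) v (DistF s t)\<bar> \<le> diam_bound L"
    using Metric_space.nonneg[OF metric] by simp
qed

lemma uniformly_bounded_PredF:
  assumes "is_formula L (PredF p ts)"
  shows "uniformly_bounded (PredF p ts)"
proof (rule uniformly_boundedI)
  fix i and v :: "nat \<Rightarrow> 'a" assume "range v \<subseteq> mdom (M i)"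
  then have "map (val_term (M i) v) ts \<in> tuples (pred_ar L p) (mdom (M i))"
    using val_term_in_mdom[OF struct] assms by (auto simp: tuples_def)
  then have "pred_lower L p \<le> val (M i) v (PredF p ts)" "val (M i) v (PredF p ts) \<le> pred_upper L p"
    using struct[of i] assms by (auto simp: metric_structure_def)
  then show "\<bar>val (M i) v (PredF p ts)\<bar> \<le> max \<bar>pred_lower L p\<bar> \<bar>pred_upper L p\<bar>"
    by linarith
qed

lemma palyutin_uniformly_bounded: "palyutin L \<phi> \<Longrightarrow> uniformly_bounded \<phi>"
  by (induction rule: palyutin.induct)
    (simp_all add: uniformly_bounded_DistF uniformly_bounded_PredF uniformly_bounded_UnF
      uniformly_bounded_MaxF2 uniformly_bounded_MinF3 uniformly_bounded_quantifiers del: is_formula.simps(2))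

section \<open>Los theorem for Palyutin formulas\<close>

lemma limsup_valuedD:
  "limsup_valued \<phi> \<Longrightarrow> range w \<subseteq> prod_dom M \<Longrightarrow>
     val prodF (cls w) \<phi> = flimsup F (\<lambda>i. val (M i) (coord w i) \<phi>)"
  by (simp add: limsup_valued_def)

text \<open>The factor bound passes through the limit superior; this is what makes
  \<open>INF\<close> and \<open>SUP\<close> over the domain of the reduced product usable.\<close>

lemma limsup_valued_bounded:
  assumes "uniformly_bounded \<phi>" "limsup_valued \<phi>"
  obtains B where "\<And>v. range v \<subseteq> mdom prodF \<Longrightarrow> \<bar>val prodF v \<phi>\<bar> \<le> B"
proof -
  obtain B where B: "\<And>i v. range v \<subseteq> mdom (M i) \<Longrightarrow> \<bar>val (M i) v \<phi>\<bar> \<le> B"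
    using assms(1) by (rule uniformly_boundedE) blast
  have "\<bar>val prodF v \<phi>\<bar> \<le> B" if v: "range v \<subseteq> mdom prodF" for v
  proof -
    define w where "w = (\<lambda>x. rep (v x))"
    have "v x \<in> mdom prodF" for x
      using v by auto
    then have w: "range w \<subseteq> prod_dom M" and v_eq: "cls w = v"
      using red_class_rep unfolding w_def by (simp_all add: image_subset_iff)
    have "\<bar>flimsup F (\<lambda>i. val (M i) (coord w i) \<phi>)\<bar> \<le> B"
      by (intro flimsup_bounded[OF proper] B range_coord[OF w])
    then show ?thesis
      using limsup_valuedD[OF assms(2) w] by (simp add: v_eq)
  qed
  then show ?thesis by (rule that)
qed

lemma limsup_valued_bdd:
  assumes "uniformly_bounded \<phi>" "limsup_valued \<phi>" "range v \<subseteq> mdom prodF"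
  shows "bdd_below ((\<lambda>a. val prodF (v(x := a)) \<phi>) ` mdom prodF)"
    and "bdd_above ((\<lambda>a. val prodF (v(x := a)) \<phi>) ` mdom prodF)"
proof -
  obtain B where B: "\<And>v. range v \<subseteq> mdom prodF \<Longrightarrow> \<bar>val prodF v \<phi>\<bar> \<le> B"
    using assms(1,2) by (rule limsup_valued_bounded) blast
  have *: "- B \<le> val prodF (v(x := a)) \<phi>" "val prodF (v(x := a)) \<phi> \<le> B" if "a \<in> mdom prodF" for a
    using B[OF range_fun_upd_subset[OF assms(3) that, of x]] by linarith+
  show "bdd_below ((\<lambda>a. val prodF (v(x := a)) \<phi>) ` mdom prodF)"
    using *(1) by (rule bdd_belowI2)
  show "bdd_above ((\<lambda>a. val prodF (v(x := a)) \<phi>) ` mdom prodF)"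
    using *(2) by (rule bdd_aboveI2)
qed

lemma limsup_valued_DistF:
  assumes "is_term L s" "is_term L t"
  shows "limsup_valued (DistF s t)"
  unfolding limsup_valued_def
proof (intro allI impI)
  fix w :: "nat \<Rightarrow> 'i \<Rightarrow> 'a" assume w: "range w \<subseteq> prod_dom M"
  have "(\<lambda>i. val_term (M i) (coord w i) r) \<in> prod_dom M" if "is_term L r" for r
    using val_term_in_mdom[OF struct range_coord[OF w] that] by (simp add: prod_dom_def)
  then show "val prodF (cls w) (DistF s t) = flimsup F (\<lambda>i. val (M i) (coord w i) (DistF s t))"
    using assms w by (simp add: val_term_prodF red_dst)
qed

lemma limsup_valued_PredF:
  assumes "is_formula L (PredF p ts)"
  shows "limsup_valued (PredF p ts)"
  unfolding limsup_valued_def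
proof (intro allI impI)
  fix w :: "nat \<Rightarrow> 'i \<Rightarrow> 'a" assume w: "range w \<subseteq> prod_dom M"
  let ?as = "map (\<lambda>t i. val_term (M i) (coord w i) t) ts"
  have args: "map (val_term prodF (cls w)) ts = map (red_class F M) ?as"
    using val_term_prodF[OF w] assms by simp
  have "set ?as \<subseteq> prod_dom M"
    using assms val_term_in_mdom[OF struct range_coord[OF w]] by (auto simp: prod_dom_def)
  then have "val prodF (cls w) (PredF p ts) = flimsup F (\<lambda>i. pred_int (M i) p (map (\<lambda>a. a i) ?as))"
    using red_pred[of p ?as] assms by (simp add: args del: map_map)
  then show "val prodF (cls w) (PredF p ts) = flimsup F (\<lambda>i. val (M i) (coord w i) (PredF p ts))"
    by (simp add: o_def)
qed

lemma limsup_valued_UnF: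
  assumes "uniformly_bounded \<phi>" "limsup_valued \<phi>" "unary_connective C" "mono C"
  shows "limsup_valued (UnF C \<phi>)"
  unfolding limsup_valued_def
proof (intro allI impI)
  fix w :: "nat \<Rightarrow> 'i \<Rightarrow> 'a" assume w: "range w \<subseteq> prod_dom M"
  obtain B where B: "\<And>i v. range v \<subseteq> mdom (M i) \<Longrightarrow> \<bar>val (M i) v \<phi>\<bar> \<le> B"
    using assms(1) by (rule uniformly_boundedE) blast
  obtain B' where B': "\<And>i v. range v \<subseteq> mdom (M i) \<Longrightarrow> \<bar>val (M i) v (UnF C \<phi>)\<bar> \<le> B'"
    using uniformly_bounded_UnF assms(1,4) by (metis uniformly_boundedE)
  show "val prodF (cls w) (UnF C \<phi>) = flimsup F (\<lambda>i. val (M i) (coord w i) (UnF C \<phi>))"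
    unfolding val_UnF limsup_valuedD[OF assms(2) w]
    using B[OF range_coord[OF w]] B'[OF range_coord[OF w]] assms(3,4)
    by (intro flimsup_mono_comp[symmetric, OF proper]) (simp_all only: val_UnF)
qed

lemma limsup_valued_MaxF2:
  assumes "uniformly_bounded \<phi>" "limsup_valued \<phi>" "uniformly_bounded \<psi>" "limsup_valued \<psi>"
  shows "limsup_valued (MaxF [\<phi>, \<psi>])"
  unfolding limsup_valued_def
proof (intro allI impI)
  fix w :: "nat \<Rightarrow> 'i \<Rightarrow> 'a" assume w: "range w \<subseteq> prod_dom M"
  obtain B where B: "\<And>i v. range v \<subseteq> mdom (M i) \<Longrightarrow> \<bar>val (M i) v \<phi>\<bar> \<le> B"
    using assms(1) by (rule uniformly_boundedE) blast
  obtain B' where B': "\<And>i v. range v \<subseteq> mdom (M i) \<Longrightarrow> \<bar>val (M i) v \<psi>\<bar> \<le> B'"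
    using assms(3) by (rule uniformly_boundedE) blast
  show "val prodF (cls w) (MaxF [\<phi>, \<psi>]) = flimsup F (\<lambda>i. val (M i) (coord w i) (MaxF [\<phi>, \<psi>]))"
    using flimsup_max[OF proper B[OF range_coord[OF w]] B'[OF range_coord[OF w]]]
    by (simp add: limsup_valuedD[OF _ w] assms)
qed

lemma val_upd:
  assumes "limsup_valued \<phi>" "range w \<subseteq> prod_dom M" "b \<in> prod_dom M"
  shows "val prodF ((cls w)(x := red_class F M b)) \<phi> =
           flimsup F (\<lambda>i. val (M i) ((coord w i)(x := b i)) \<phi>)"
  unfolding cls_upd coord_upd
  using assms by (intro limsup_valuedD range_fun_upd_subset)

text \<open>Elements chosen independently in the factors always form an element of the product. The
  glued witnesses of the quantifier steps arise in this way.\<close>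

lemma prod_dom_choice:
  assumes "\<And>i. \<exists>a\<in>mdom (M i). P i a"
  obtains b where "b \<in> prod_dom M" "\<And>i. P i (b i)"
  using assms unfolding prod_dom_def Pi_iff by metis

text \<open>A witness in the reduced product is, through a representative, a witness on a set in the
  filter. Conversely, near minimizers of all factors glue to one element \<open>b\<close>, whose
  value in the reduced product is at least the infimum there.\<close>

lemma limsup_valued_InfF:
  assumes bd: "uniformly_bounded \<phi>" and lv: "limsup_valued \<phi>"
  shows "limsup_valued (InfF x \<phi>)"
  unfolding limsup_valued_def
proof (intro allI impI)
  fix w :: "nat \<Rightarrow> 'i \<Rightarrow> 'a" assume w: "range w \<subseteq> prod_dom M"
  obtain B where B: "\<And>i v. range v \<subseteq> mdom (M i) \<Longrightarrow> \<bar>val (M i) v \<phi>\<bar> \<le> B"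
    using bd by (rule uniformly_boundedE) blast
  obtain B' where B': "\<And>i v. range v \<subseteq> mdom (M i) \<Longrightarrow> \<bar>val (M i) v (InfF x \<phi>)\<bar> \<le> B'"
    using uniformly_bounded_quantifiers(1)[OF bd] by (rule uniformly_boundedE) blast
  have Bb: "\<bar>val (M i) ((coord w i)(x := b i)) \<phi>\<bar> \<le> B" if "b \<in> prod_dom M" for b i
    using that by (intro B range_fun_upd_subset range_coord[OF w]) (simp add: prod_dom_def Pi_iff)
  have wM: "range (cls w) \<subseteq> mdom prodF"
    using w by (auto simp: mdom_prodF)
  have lower: "val prodF (cls w) (InfF x \<phi>) \<le> flimsup F (\<lambda>i. val (M i) ((coord w i)(x := b i)) \<phi>)"
    if "b \<in> prod_dom M" for b
    unfolding val_upd[OF lv w that, symmetric] val.simps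
    using that by (intro cINF_lower limsup_valued_bdd[OF bd lv wM]) (simp add: mdom_prodF)
  show "val prodF (cls w) (InfF x \<phi>) = flimsup F (\<lambda>i. val (M i) (coord w i) (InfF x \<phi>))"
  proof (rule flimsup_eqI[OF proper B'[OF range_coord[OF w]], symmetric])
    fix c assume "val prodF (cls w) (InfF x \<phi>) < c"
    then obtain A where "A \<in> mdom prodF" "val prodF ((cls w)(x := A)) \<phi> < c"
      using cInf_lessD[of "(\<lambda>A. val prodF ((cls w)(x := A)) \<phi>) ` mdom prodF"] mdom_prodF_nonempty
      by auto
    then obtain b where b: "b \<in> prod_dom M" "val prodF ((cls w)(x := red_class F M b)) \<phi> < c"
      by (auto simp: mdom_prodF)
    have "\<forall>\<^sub>F i in F. val (M i) ((coord w i)(x := b i)) \<phi> < c"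
      using b(2) unfolding val_upd[OF lv w b(1)] by (rule flimsup_less[OF proper Bb[OF b(1)]])
    then show "\<forall>\<^sub>F i in F. val (M i) (coord w i) (InfF x \<phi>) \<le> c"
    proof (rule eventually_mono)
      fix i assume i: "val (M i) ((coord w i)(x := b i)) \<phi> < c"
      have "val (M i) (coord w i) (InfF x \<phi>) \<le> val (M i) ((coord w i)(x := b i)) \<phi>"
        unfolding val.simps using b(1)
        by (intro cINF_lower uniformly_bounded_bdd[OF bd range_coord[OF w]]) (simp add: prod_dom_def Pi_iff)
      then show "val (M i) (coord w i) (InfF x \<phi>) \<le> c"
        using i by linarith
    qed
  next
    fix c assume c: "c < val prodF (cls w) (InfF x \<phi>)"
    then obtain d where d: "c < d" "d < val prodF (cls w) (InfF x \<phi>)"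
      using dense by blast
    \<comment> \<open>The gap \<open>d - c\<close> is the tolerance for near minimizers: a value
      above \<open>d\<close> at \<open>b i\<close> still puts the infimum above
      \<open>c\<close>.\<close>
    have "\<exists>a\<in>mdom (M i). val (M i) ((coord w i)(x := a)) \<phi> < val (M i) (coord w i) (InfF x \<phi>) + (d - c)" for i
      using cInf_lessD[of "(\<lambda>a. val (M i) ((coord w i)(x := a)) \<phi>) ` mdom (M i)"
          "val (M i) (coord w i) (InfF x \<phi>) + (d - c)"] mdom_nonempty d(1) by auto
    then obtain b where b: "b \<in> prod_dom M"
      "\<And>i. val (M i) ((coord w i)(x := b i)) \<phi> < val (M i) (coord w i) (InfF x \<phi>) + (d - c)"
      by (rule prod_dom_choice) blast
    have "\<exists>\<^sub>F i in F. d < val (M i) ((coord w i)(x := b i)) \<phi>"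
      using d(2) lower[OF b(1)] by (intro flimsup_greater[OF proper Bb[OF b(1)]]) linarith
    then show "\<exists>\<^sub>F i in F. c \<le> val (M i) (coord w i) (InfF x \<phi>)"
    proof (rule frequently_elim1)
      fix i assume "d < val (M i) ((coord w i)(x := b i)) \<phi>"
      then show "c \<le> val (M i) (coord w i) (InfF x \<phi>)"
        using b(2)[of i] by linarith
    qed
  qed
qed

text \<open>The tests exchange their methods: near maximizers are glued to bound the factor suprema
  from above, while a single class is the witness on a positive set.\<close>

lemma limsup_valued_SupF:
  assumes bd: "uniformly_bounded \<phi>" and lv: "limsup_valued \<phi>"
  shows "limsup_valued (SupF x \<phi>)"
  unfolding limsup_valued_def
proof (intro allI impI)
  fix w :: "nat \<Rightarrow> 'i \<Rightarrow> 'a" assume w: "range w \<subseteq> prod_dom M"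
  obtain B where B: "\<And>i v. range v \<subseteq> mdom (M i) \<Longrightarrow> \<bar>val (M i) v \<phi>\<bar> \<le> B"
    using bd by (rule uniformly_boundedE) blast
  obtain B' where B': "\<And>i v. range v \<subseteq> mdom (M i) \<Longrightarrow> \<bar>val (M i) v (SupF x \<phi>)\<bar> \<le> B'"
    using uniformly_bounded_quantifiers(2)[OF bd] by (rule uniformly_boundedE) blast
  have Bb: "\<bar>val (M i) ((coord w i)(x := b i)) \<phi>\<bar> \<le> B" if "b \<in> prod_dom M" for b i
    using that by (intro B range_fun_upd_subset range_coord[OF w]) (simp add: prod_dom_def Pi_iff)
  have wM: "range (cls w) \<subseteq> mdom prodF"
    using w by (auto simp: mdom_prodF)
  have upper: "flimsup F (\<lambda>i. val (M i) ((coord w i)(x := b i)) \<phi>) \<le> val prodF (cls w) (SupF x \<phi>)"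
    if "b \<in> prod_dom M" for b
    unfolding val_upd[OF lv w that, symmetric] val.simps
    using that by (intro cSUP_upper limsup_valued_bdd[OF bd lv wM]) (simp add: mdom_prodF)
  show "val prodF (cls w) (SupF x \<phi>) = flimsup F (\<lambda>i. val (M i) (coord w i) (SupF x \<phi>))"
  proof (rule flimsup_eqI[OF proper B'[OF range_coord[OF w]], symmetric])
    fix c assume "val prodF (cls w) (SupF x \<phi>) < c"
    then obtain d where d: "d < c" "val prodF (cls w) (SupF x \<phi>) < d"
      using dense by blast
    have "\<exists>a\<in>mdom (M i). val (M i) (coord w i) (SupF x \<phi>) - (c - d) < val (M i) ((coord w i)(x := a)) \<phi>" for i
      using less_cSupD[of "(\<lambda>a. val (M i) ((coord w i)(x := a)) \<phi>) ` mdom (M i)"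
          "val (M i) (coord w i) (SupF x \<phi>) - (c - d)"] mdom_nonempty d(1) by auto
    then obtain b where b: "b \<in> prod_dom M"
      "\<And>i. val (M i) (coord w i) (SupF x \<phi>) - (c - d) < val (M i) ((coord w i)(x := b i)) \<phi>"
      by (rule prod_dom_choice) blast
    have "\<forall>\<^sub>F i in F. val (M i) ((coord w i)(x := b i)) \<phi> < d"
      using d(2) upper[OF b(1)] by (intro flimsup_less[OF proper Bb[OF b(1)]]) linarith
    then show "\<forall>\<^sub>F i in F. val (M i) (coord w i) (SupF x \<phi>) \<le> c"
    proof (rule eventually_mono)
      fix i assume "val (M i) ((coord w i)(x := b i)) \<phi> < d"
      then show "val (M i) (coord w i) (SupF x \<phi>) \<le> c"
        using b(2)[of i] by linarith
    qed
  next
    fix c assume "c < val prodF (cls w) (SupF x \<phi>)"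
    then obtain A where "A \<in> mdom prodF" "c < val prodF ((cls w)(x := A)) \<phi>"
      using less_cSupD[of "(\<lambda>A. val prodF ((cls w)(x := A)) \<phi>) ` mdom prodF"] mdom_prodF_nonempty
      by auto
    then obtain b where b: "b \<in> prod_dom M" "c < val prodF ((cls w)(x := red_class F M b)) \<phi>"
      by (auto simp: mdom_prodF)
    have "\<exists>\<^sub>F i in F. c < val (M i) ((coord w i)(x := b i)) \<phi>"
      using b(2) unfolding val_upd[OF lv w b(1)] by (rule flimsup_greater[OF proper Bb[OF b(1)]])
    then show "\<exists>\<^sub>F i in F. c \<le> val (M i) (coord w i) (SupF x \<phi>)"
    proof (rule frequently_elim1)
      fix i assume i: "c < val (M i) ((coord w i)(x := b i)) \<phi>"
      have "val (M i) ((coord w i)(x := b i)) \<phi> \<le> val (M i) (coord w i) (SupF x \<phi>)"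
        unfolding val.simps using b(1)
        by (intro cSUP_upper uniformly_bounded_bdd[OF bd range_coord[OF w]]) (simp add: prod_dom_def Pi_iff)
      then show "c \<le> val (M i) (coord w i) (SupF x \<phi>)"
        using i by linarith
    qed
  qed
qed


text \<open>A lower bound on \<open>D\<close> of a limit superior needs \<open>D \<phi>\<close>
  large on a set in the filter, whereas a large supremum in the factors may occur only on a positive
  set. The first component of the maximum repairs this: where no witness is offered, a small infimum
  of \<phi> supplies an element with \<open>D \<phi>\<close> at least \<Delta>, and the cap \<Delta>
  makes that enough.\<close>

lemma limsup_valued_fix:
  assumes bd: "uniformly_bounded \<phi>" "uniformly_bounded \<psi>"
    and lv: "limsup_valued \<phi>" "limsup_valued \<psi>"
    and D: "unary_connective D" "antimono D" "D \<Delta> = \<Delta>"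
  shows "limsup_valued (MaxF [InfF x \<phi>, SupF x (MinF [UnF D \<phi>, ConstF \<Delta>, \<psi>])])"
    (is "limsup_valued (MaxF [?I, SupF x ?m])")
  unfolding limsup_valued_def
proof (intro allI impI)
  fix w :: "nat \<Rightarrow> 'i \<Rightarrow> 'a" assume w: "range w \<subseteq> prod_dom M"
  let ?X = "MaxF [?I, SupF x ?m]"
  have bdm: "uniformly_bounded ?m"
    using bd D by (intro uniformly_bounded_MinF3 uniformly_bounded_UnF) auto
  have bdX: "uniformly_bounded ?X"
    using bd bdm by (intro uniformly_bounded_MaxF2 uniformly_bounded_quantifiers)
  obtain B1 where B1: "\<And>i v. range v \<subseteq> mdom (M i) \<Longrightarrow> \<bar>val (M i) v \<phi>\<bar> \<le> B1"
    using bd(1) by (rule uniformly_boundedE) blast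
  obtain B2 where B2: "\<And>i v. range v \<subseteq> mdom (M i) \<Longrightarrow> \<bar>val (M i) v \<psi>\<bar> \<le> B2"
    using bd(2) by (rule uniformly_boundedE) blast
  obtain B3 where B3: "\<And>i v. range v \<subseteq> mdom (M i) \<Longrightarrow> \<bar>val (M i) v ?I\<bar> \<le> B3"
    using uniformly_bounded_quantifiers(1)[OF bd(1)] by (rule uniformly_boundedE) blast
  obtain B4 where B4: "\<And>i v. range v \<subseteq> mdom (M i) \<Longrightarrow> \<bar>val (M i) v ?X\<bar> \<le> B4"
    using bdX by (rule uniformly_boundedE) blast
  have upd_range: "range ((coord w i)(x := b i)) \<subseteq> mdom (M i)" if "b \<in> prod_dom M" for b i
    using that by (intro range_fun_upd_subset range_coord[OF w]) (simp add: prod_dom_def Pi_iff)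
  have wM: "range (cls w) \<subseteq> mdom prodF"
    using w by (auto simp: mdom_prodF)
  define p where "p = (\<lambda>b i. val (M i) ((coord w i)(x := b i)) \<phi>)"
  define q where "q = (\<lambda>b i. val (M i) ((coord w i)(x := b i)) \<psi>)"
  define r where "r = flimsup F (\<lambda>i. val (M i) (coord w i) ?I)"
  have pB: "\<bar>p b i\<bar> \<le> B1" and qB: "\<bar>q b i\<bar> \<le> B2" if "b \<in> prod_dom M" for b i
    unfolding p_def q_def by (rule B1[OF upd_range[OF that]], rule B2[OF upd_range[OF that]])
  have I: "val prodF (cls w) ?I = r"
    unfolding r_def by (rule limsup_valuedD[OF limsup_valued_InfF[OF bd(1) lv(1)] w])
  have m: "val prodF ((cls w)(x := red_class F M b)) ?m = min (D (flimsup F (p b))) (min \<Delta> (flimsup F (q b)))"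
    if "b \<in> prod_dom M" for b
    unfolding p_def q_def by (simp add: val_upd[OF lv(1) w that] val_upd[OF lv(2) w that])
  have m_i: "val (M i) ((coord w i)(x := b i)) ?m = min (D (p b i)) (min \<Delta> (q b i))" for b i
    unfolding p_def q_def by simp
  \<comment> \<open>The Los property is not at hand for the minimum, so its bound in the reduced
    product comes from the constant \<Delta>.\<close>
  have "bdd_above ((\<lambda>A. val prodF ((cls w)(x := A)) ?m) ` mdom prodF)"
    by (rule bdd_aboveI2[where M = \<Delta>]) simp
  then have upper: "min (D (flimsup F (p b))) (min \<Delta> (flimsup F (q b))) \<le> val prodF (cls w) (SupF x ?m)"
    if "b \<in> prod_dom M" for b
    unfolding m[OF that, symmetric] val.simps(4)
    using that by (intro cSUP_upper) (simp_all add: mdom_prodF)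
  have upper_i: "min (D (p b i)) (min \<Delta> (q b i)) \<le> val (M i) (coord w i) (SupF x ?m)"
    if "b \<in> prod_dom M" for b i
    unfolding m_i[symmetric] val.simps(4) using that
    by (intro cSUP_upper uniformly_bounded_bdd[OF bdm range_coord[OF w]]) (simp add: prod_dom_def Pi_iff)
  have le_\<Delta>: "val (M i) (coord w i) (SupF x ?m) \<le> \<Delta>" for i
    unfolding val.simps(4) using mdom_nonempty by (intro cSUP_least) auto
  show "val prodF (cls w) ?X = flimsup F (\<lambda>i. val (M i) (coord w i) ?X)"
  proof (rule flimsup_eqI[OF proper B4[OF range_coord[OF w]], symmetric])
    fix c assume "val prodF (cls w) ?X < c"
    then have c: "r < c" "val prodF (cls w) (SupF x ?m) < c"
      unfolding val_MaxF2 I by linarith+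
    have inf_c: "\<forall>\<^sub>F i in F. val (M i) (coord w i) ?I < t" if "r < t" for t
      using that unfolding r_def by (rule flimsup_less[OF proper B3[OF range_coord[OF w]]])
    \<comment> \<open>If \<Delta> is at most \<open>c\<close>, the cap settles the claim. Otherwise
      \<open>r < c < \<Delta>\<close>, so the infimum of \<phi> is below \<Delta> on a set in the
      filter.\<close>
    have sup_c: "\<forall>\<^sub>F i in F. val (M i) (coord w i) (SupF x ?m) \<le> c"
    proof (cases "\<Delta> \<le> c")
      case True
      then show ?thesis
        using le_\<Delta> by (intro always_eventually allI) (meson order_trans)
    next
      case False
      show ?thesis
      proof (rule ccontr)
        assume "\<not> ?thesis"
        then have freq: "\<exists>\<^sub>F i in F. c < val (M i) (coord w i) (SupF x ?m)"
          by (simp add: frequently_def not_less)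
        text \<open>
          On the indices where the supremum exceeds \<open>c\<close> pick a witness; elsewhere make \<open>\<phi>\<close> smaller
          than \<open>\<Delta>\<close>, which forces \<open>D \<phi> \<ge> D \<Delta> = \<Delta>\<close>.
        \<close>
        have "\<exists>a\<in>mdom (M i).
            if c < val (M i) (coord w i) (SupF x ?m) then c < val (M i) ((coord w i)(x := a)) ?m
            else val (M i) (coord w i) ?I < \<Delta> \<longrightarrow> val (M i) ((coord w i)(x := a)) \<phi> < \<Delta>" for i
        proof (cases "c < val (M i) (coord w i) (SupF x ?m)")
          case True
          then show ?thesis
            using less_cSupD[of "(\<lambda>a. val (M i) ((coord w i)(x := a)) ?m) ` mdom (M i)" c] mdom_nonempty
            unfolding val.simps(4) by auto
        next
          case False
          show ?thesis
          proof (cases "val (M i) (coord w i) ?I < \<Delta>")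
            case True
            then obtain a where "a \<in> mdom (M i)" "val (M i) ((coord w i)(x := a)) \<phi> < \<Delta>"
              using cInf_lessD[of "(\<lambda>a. val (M i) ((coord w i)(x := a)) \<phi>) ` mdom (M i)" \<Delta>] mdom_nonempty
              unfolding val.simps(5) by auto
            then show ?thesis using False by auto
          next
            case inf: False
            then show ?thesis using False mdom_nonempty[of i] by auto
          qed
        qed
        then obtain b where b: "b \<in> prod_dom M"
          "\<And>i. if c < val (M i) (coord w i) (SupF x ?m) then c < val (M i) ((coord w i)(x := b i)) ?m
              else val (M i) (coord w i) ?I < \<Delta> \<longrightarrow> p b i < \<Delta>"
          unfolding p_def by (rule prod_dom_choice) blast
        have ev: "\<forall>\<^sub>F i in F. c \<le> D (p b i)"
          using inf_c[of \<Delta>] c(1) False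
        proof (rule_tac eventually_mono)
          fix i assume i: "val (M i) (coord w i) ?I < \<Delta>"
          show "c \<le> D (p b i)"
          proof (cases "c < val (M i) (coord w i) (SupF x ?m)")
            case True
            then show ?thesis using b(2)[of i] by (simp add: m_i del: val_MinF3)
          next
            case le: False
            then have "D \<Delta> \<le> D (p b i)"
              using b(2)[of i] i by (intro antimonoD[OF D(2)]) simp
            then show ?thesis using False D(3) by linarith
          qed
        qed simp
        \<comment> \<open>Otherwise some \<open>t\<close> strictly below the limit superior has
          \<open>D t < c\<close>; then \<open>p b i > t\<close> on a positive set, which meets the
          filter set of \<open>ev\<close> in a contradictory index.\<close>
        have "c \<le> D (flimsup F (p b))"
        proof (rule ccontr)
          assume "\<not> c \<le> D (flimsup F (p b))"
          then obtain t where t: "t < flimsup F (p b)" "D t < c"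
            using continuous_real_neighbours(1)[OF D(1)] by (meson not_le)
          have "\<exists>\<^sub>F i in F. t < p b i"
            using t(1) by (rule flimsup_greater[OF proper pB[OF b(1)]])
          then have "\<exists>\<^sub>F i in F. c \<le> D (p b i) \<and> t < p b i"
            using ev by (rule frequently_eventually_conj)
          then obtain i where i: "t < p b i" "c \<le> D (p b i)"
            by (auto dest: frequently_ex)
          then show False
            using antimonoD[OF D(2), of t "p b i"] t(2) by linarith
        qed
        \<comment> \<open>For \<psi> positivity suffices: on the indices of \<open>freq\<close> the
          element \<open>b i\<close> is a genuine witness.\<close>
        moreover have "c \<le> flimsup F (q b)"
        proof (rule le_flimsup[OF proper qB[OF b(1)]])
          show "\<exists>\<^sub>F i in F. c \<le> q b i"
            using freq
          proof (rule frequently_elim1)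
            fix i assume "c < val (M i) (coord w i) (SupF x ?m)"
            then show "c \<le> q b i" using b(2)[of i] by (simp add: m_i del: val_MinF3)
          qed
        qed
        ultimately show False
          using upper[OF b(1)] c(2) False by linarith
      qed
    qed
    show "\<forall>\<^sub>F i in F. val (M i) (coord w i) ?X \<le> c"
      using inf_c[OF c(1)] sup_c
    proof eventually_elim
      case (elim i)
      then show ?case unfolding val_MaxF2 by linarith
    qed
  next
    fix c assume "c < val prodF (cls w) ?X"
    then consider "c < r" | "c < val prodF (cls w) (SupF x ?m)"
      unfolding val_MaxF2 I by linarith
    then show "\<exists>\<^sub>F i in F. c \<le> val (M i) (coord w i) ?X"
    proof cases
      case 1
      then have "\<exists>\<^sub>F i in F. c < val (M i) (coord w i) ?I"
        unfolding r_def by (rule flimsup_greater[OF proper B3[OF range_coord[OF w]]])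
      then show ?thesis
        by (rule frequently_elim1) (simp only: val_MaxF2 le_max_iff_disj, linarith)
    next
      case 2
      then obtain A where "A \<in> mdom prodF" "c < val prodF ((cls w)(x := A)) ?m"
        using less_cSupD[of "(\<lambda>A. val prodF ((cls w)(x := A)) ?m) ` mdom prodF"] mdom_prodF_nonempty
        unfolding val.simps(4) by auto
      then obtain b where b: "b \<in> prod_dom M" "c < val prodF ((cls w)(x := red_class F M b)) ?m"
        unfolding mdom_prodF by blast
      then have c: "c < D (flimsup F (p b))" "c < \<Delta>" "c < flimsup F (q b)"
        unfolding m[OF b(1)] by linarith+
      \<comment> \<open>The bound \<open>p b i < t\<close>, and with it
        \<open>D (p b i) > c\<close>, holds on a set in the filter, which meets the positive set
        where \<open>q b i > c\<close> in a positive set.\<close>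
      obtain t where t: "flimsup F (p b) < t" "c < D t"
        using c(1) continuous_real_neighbours(4)[OF D(1)] by blast
      have "\<exists>\<^sub>F i in F. c < q b i"
        using c(3) by (rule flimsup_greater[OF proper qB[OF b(1)]])
      moreover have "\<forall>\<^sub>F i in F. p b i < t"
        using t(1) by (rule flimsup_less[OF proper pB[OF b(1)]])
      ultimately have "\<exists>\<^sub>F i in F. p b i < t \<and> c < q b i"
        by (rule frequently_eventually_conj)
      then show ?thesis
      proof (rule frequently_elim1)
        fix i assume i: "p b i < t \<and> c < q b i"
        then have "c < D (p b i)"
          using antimonoD[OF D(2), of "p b i" t] t(2) by linarith
        then have "c \<le> val (M i) (coord w i) (SupF x ?m)"
          using upper_i[OF b(1), of i] i c(2) by linarith
        then show "c \<le> val (M i) (coord w i) ?X"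
          unfolding val_MaxF2 by linarith
      qed
    qed
  qed
qed

theorem palyutin_limsup_valued: "palyutin L \<phi> \<Longrightarrow> limsup_valued \<phi>"
proof (induction rule: palyutin.induct)
  case (pal_dist s t)
  then show ?case by (simp add: limsup_valued_DistF)
next
  case (pal_pred p ts)
  then show ?case by (rule limsup_valued_PredF)
qed (auto intro: limsup_valued_UnF limsup_valued_MaxF2 limsup_valued_InfF limsup_valued_SupF
    limsup_valued_fix palyutin_uniformly_bounded)


section \<open>Gluing separate witnesses into one\<close>

text \<open>The two kinds of condition tolerate gluing for different reasons. All witnesses keep
  \<phi> below \<open>s\<close> on one common set in the filter, so any mixture of them does too;
  each \<psi> has to be large only on a positive set, so a private block of indices for each is
  enough.\<close>

lemma scp_matrix_le:
  assumes split: "\<And>X. \<exists>\<^sub>F i in F. i \<in> X \<Longrightarrow> \<exists>Y\<subseteq>X. (\<exists>\<^sub>F i in F. i \<in> Y) \<and> (\<exists>\<^sub>F i in F. i \<in> X - Y)"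
    and n: "0 < length Ds" "length \<psi>s = length Ds"
    and pal: "palyutin L \<phi>" "\<And>\<psi>. \<psi> \<in> set \<psi>s \<Longrightarrow> palyutin L \<psi>"
    and D: "\<And>D. D \<in> set Ds \<Longrightarrow> unary_connective D \<and> antimono D"
    and v: "range v \<subseteq> mdom prodF"
  shows "val prodF v (InfsF xs (MaxF (\<phi> # map2 UnF Ds \<psi>s))) \<le>
           val prodF v (MaxF (map2 (\<lambda>D \<psi>. InfsF xs (MaxF [\<phi>, UnF D \<psi>])) Ds \<psi>s))"
    (is "val prodF v (InfsF xs ?\<theta>) \<le> ?r")
proof (rule dense_ge)
  fix s assume s: "?r < s"
  let ?n = "length Ds"
  have map2_set: "set (map2 g Ds \<psi>s) = (\<lambda>j. g (Ds ! j) (\<psi>s ! j)) ` {..<?n}" for g :: "_ \<Rightarrow> _ \<Rightarrow> ('f, 'p) fm"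
    using n(2) by (force simp: set_zip)
  have ne: "map2 g Ds \<psi>s \<noteq> []" for g :: "_ \<Rightarrow> _ \<Rightarrow> ('f, 'p) fm"
    using n by (cases Ds; cases \<psi>s) auto
  have "\<exists>v'. range v' \<subseteq> mdom prodF \<and> (\<forall>x. x \<notin> set xs \<longrightarrow> v' x = v x) \<and>
      val prodF v' (MaxF [\<phi>, UnF (Ds ! j) (\<psi>s ! j)]) < s" if "j < ?n" for j
  proof -
    have "val prodF v (InfsF xs (MaxF [\<phi>, UnF (Ds ! j) (\<psi>s ! j)])) \<le> ?r"
      unfolding val_MaxF[OF ne] map2_set using that by (intro Max_ge) auto
    then show ?thesis
      using s by (intro val_InfsF_lessD mdom_prodF_nonempty v) linarith
  qed
  then obtain vs where vs: "\<And>j. j < ?n \<Longrightarrow> range (vs j) \<subseteq> mdom prodF"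
      "\<And>j x. j < ?n \<Longrightarrow> x \<notin> set xs \<Longrightarrow> vs j x = v x"
      "\<And>j. j < ?n \<Longrightarrow> val prodF (vs j) (MaxF [\<phi>, UnF (Ds ! j) (\<psi>s ! j)]) < s"
    by metis
  \<comment> \<open>Since \<open>rep\<close> depends only on the class, all \<open>w j x\<close>
    coincide for \<open>x\<close> outside \<open>xs\<close>; hence the glued assignment leaves those
    variables untouched.\<close>
  define w where "w j x = rep (vs j x)" for j x
  have w: "range (w j) \<subseteq> prod_dom M" "cls (w j) = vs j" if "j < ?n" for j
  proof -
    have "vs j x \<in> mdom prodF" for x
      using vs(1)[OF that] by auto
    then show "range (w j) \<subseteq> prod_dom M" "cls (w j) = vs j"
      using red_class_rep unfolding w_def by (simp_all add: image_subset_iff)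
  qed
  define p where "p j i = val (M i) (coord (w j) i) \<phi>" for j i
  define q where "q j i = val (M i) (coord (w j) i) (\<psi>s ! j)" for j i
  have pal_\<psi>: "palyutin L (\<psi>s ! j)" and D_j: "unary_connective (Ds ! j)" "antimono (Ds ! j)" if "j < ?n" for j
    using that n(2) pal(2)[of "\<psi>s ! j"] D[of "Ds ! j"] by auto
  obtain B where B: "\<And>i v. range v \<subseteq> mdom (M i) \<Longrightarrow> \<bar>val (M i) v \<phi>\<bar> \<le> B"
    using palyutin_uniformly_bounded[OF pal(1)] by (rule uniformly_boundedE) blast
  have \<psi>_bd: "\<exists>B. \<forall>i v. range v \<subseteq> mdom (M i) \<longrightarrow> \<bar>val (M i) v (\<psi>s ! j)\<bar> \<le> B" if "j < ?n" for j
    using palyutin_uniformly_bounded[OF pal_\<psi>[OF that]] by (simp add: uniformly_bounded_def)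
  \<comment> \<open>By continuity the threshold can be lowered strictly below the limit superior,
    which is then exceeded on a positive set.\<close>
  have "\<exists>t. t < flimsup F (q j) \<and> (Ds ! j) t < s" if j: "j < ?n" for j
  proof -
    have "val prodF (vs j) (UnF (Ds ! j) (\<psi>s ! j)) < s"
      using vs(3)[OF j] by (simp only: val_MaxF2 max_less_iff_conj)
    then have "(Ds ! j) (flimsup F (q j)) < s"
      using limsup_valuedD[OF palyutin_limsup_valued[OF pal_\<psi>[OF j]] w(1)[OF j]]
      by (simp add: q_def[abs_def] w(2)[OF j])
    then show ?thesis
      using continuous_real_neighbours(1)[OF D_j(1)[OF j]] by blast
  qed
  then obtain t where t: "\<And>j. j < ?n \<Longrightarrow> t j < flimsup F (q j)" "\<And>j. j < ?n \<Longrightarrow> (Ds ! j) (t j) < s"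
    by metis
  have "\<exists>\<^sub>F i in F. i \<in> {i. t j < q j i}" if j: "j < ?n" for j
  proof -
    obtain B' where B': "\<And>i v. range v \<subseteq> mdom (M i) \<Longrightarrow> \<bar>val (M i) v (\<psi>s ! j)\<bar> \<le> B'"
      using \<psi>_bd[OF j] by blast
    have "\<exists>\<^sub>F i in F. t j < q j i"
    proof (rule flimsup_greater[OF proper _ t(1)[OF j]])
      show "\<bar>q j i\<bar> \<le> B'" for i
        unfolding q_def by (rule B'[OF range_coord[OF w(1)[OF j]]])
    qed
    then show ?thesis by simp
  qed
  then obtain K where K: "\<And>j. j < ?n \<Longrightarrow> K j \<subseteq> {i. t j < q j i}" "\<And>j. j < ?n \<Longrightarrow> \<exists>\<^sub>F i in F. i \<in> K j"
    and disj: "disjoint_family_on K {..<?n}"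
    using disjoint_frequent_refinement[OF split, of "?n" "\<lambda>j. {i. t j < q j i}"] by blast
  \<comment> \<open>The number of the block containing \<open>i\<close>, unique by disjointness.
    Outside all blocks the default \<open>0\<close> is a legal index because \<open>Ds\<close> is
    nonempty.\<close>
  define sel where "sel i = (if \<exists>j<?n. i \<in> K j then SOME j. j < ?n \<and> i \<in> K j else 0)" for i
  have sel: "sel i < ?n" for i
    using n(1) someI_ex[of "\<lambda>j. j < ?n \<and> i \<in> K j"] by (auto simp: sel_def)
  have sel_eq: "sel i = j" if "j < ?n" "i \<in> K j" for i j
  proof -
    have "sel i < ?n \<and> i \<in> K (sel i)"
      using that someI[of "\<lambda>j. j < ?n \<and> i \<in> K j" j] by (auto simp: sel_def)
    then show ?thesis
      using disj that by (fastforce simp: disjoint_family_on_def)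
  qed
  define u where "u x i = w (sel i) x i" for x i
  have coord_u: "coord u i = coord (w (sel i)) i" for i
    by (simp add: u_def)
  have u: "range u \<subseteq> prod_dom M"
    using w(1)[OF sel] by (auto simp: u_def prod_dom_def Pi_iff image_subset_iff)
  then have uM: "range (cls u) \<subseteq> mdom prodF"
    by (auto simp: mdom_prodF)
  have u_eq: "cls u x = v x" if x: "x \<notin> set xs" for x
  proof -
    have "w j x = rep (v x)" if "j < ?n" for j
      using vs(2)[OF that x] by (simp add: w_def)
    then have "u x = rep (v x)"
      using sel by (simp add: u_def fun_eq_iff)
    then show ?thesis
      using red_class_rep(2)[of "v x"] v by auto
  qed
  have "val prodF (cls u) \<phi> \<le> s"
    unfolding limsup_valuedD[OF palyutin_limsup_valued[OF pal(1)] u]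
  proof (rule flimsup_le[OF proper B[OF range_coord[OF u]]])
    \<comment> \<open>Finitely many sets in the filter are intersected, so the bound holds whichever
      witness \<open>sel\<close> picks.\<close>
    have "\<forall>\<^sub>F i in F. \<forall>j\<in>{..<?n}. p j i < s"
    proof (rule eventually_ball_finite; (rule finite_lessThan ballI)?)
      fix j assume "j \<in> {..<?n}"
      then have j: "j < ?n" by simp
      have "val prodF (vs j) \<phi> < s"
        using vs(3)[OF j] by (simp only: val_MaxF2 max_less_iff_conj)
      then have "flimsup F (p j) < s"
        using limsup_valuedD[OF palyutin_limsup_valued[OF pal(1)] w(1)[OF j]]
        by (simp add: p_def[abs_def] w(2)[OF j])
      then show "\<forall>\<^sub>F i in F. p j i < s"
        by (rule flimsup_less[OF proper, rotated]) (unfold p_def, rule B[OF range_coord[OF w(1)[OF j]]])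
    qed
    then show "\<forall>\<^sub>F i in F. val (M i) (coord u i) \<phi> \<le> s"
    proof (rule eventually_mono)
      fix i assume "\<forall>j\<in>{..<?n}. p j i < s"
      then have "p (sel i) i < s" using sel by blast
      then show "val (M i) (coord u i) \<phi> \<le> s"
        by (simp add: coord_u p_def)
    qed
  qed
  moreover have "(Ds ! j) (val prodF (cls u) (\<psi>s ! j)) \<le> s" if j: "j < ?n" for j
  proof -
    obtain B' where B': "\<And>i v. range v \<subseteq> mdom (M i) \<Longrightarrow> \<bar>val (M i) v (\<psi>s ! j)\<bar> \<le> B'"
      using \<psi>_bd[OF j] by blast
    \<comment> \<open>On the positive set \<open>K j\<close> the glued assignment is the
      \<open>j\<close>-th witness, where the formula exceeds \<open>t j\<close>.\<close>
    have "t j \<le> val prodF (cls u) (\<psi>s ! j)"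
      unfolding limsup_valuedD[OF palyutin_limsup_valued[OF pal_\<psi>[OF j]] u]
    proof (rule le_flimsup[OF proper B'[OF range_coord[OF u]]])
      show "\<exists>\<^sub>F i in F. t j \<le> val (M i) (coord u i) (\<psi>s ! j)"
        using K(2)[OF j]
      proof (rule frequently_elim1)
        fix i assume i: "i \<in> K j"
        then have "t j < q j i" using K(1)[OF j] by blast
        then show "t j \<le> val (M i) (coord u i) (\<psi>s ! j)"
          by (simp add: coord_u sel_eq[OF j i] q_def)
      qed
    qed
    then show ?thesis
      using antimonoD[OF D_j(2)[OF j]] t(2)[OF j] by (meson less_imp_le order_trans)
  qed
  ultimately have "val prodF (cls u) ?\<theta> \<le> s"
    by (subst val_MaxF) (auto simp: set_zip n(2))
  moreover have "val prodF v (InfsF xs ?\<theta>) \<le> val prodF (cls u) ?\<theta>"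
  proof -
    \<comment> \<open>The lower bound that \<open>val_InfsF_le\<close> asks for comes from \<phi>
      alone, one of the entries of the maximum.\<close>
    obtain C where C: "\<And>v. range v \<subseteq> mdom prodF \<Longrightarrow> \<bar>val prodF v \<phi>\<bar> \<le> C"
      using palyutin_uniformly_bounded[OF pal(1)] palyutin_limsup_valued[OF pal(1)]
      by (rule limsup_valued_bounded) blast
    have "- C \<le> val prodF v' ?\<theta>" if "range v' \<subseteq> mdom prodF" for v'
    proof -
      have "val prodF v' \<phi> \<le> val prodF v' ?\<theta>"
        by (subst val_MaxF) auto
      then show ?thesis using C[OF that] by linarith
    qed
    then show ?thesis
      by (rule val_InfsF_le[OF _ v uM u_eq])
  qed
  ultimately show "val prodF v (InfsF xs ?\<theta>) \<le> s"
    by (rule order_trans[rotated])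
qed

text \<open>Assuming the splitting property of positive sets serves both atomless Boolean algebras
  and the cofinite filter. The outer suprema reduce the claim to the matrix inequality at each
  assignment.\<close>

theorem reduced_product_SCP:
  assumes "\<And>X. \<exists>\<^sub>F i in F. i \<in> X \<Longrightarrow> \<exists>Y\<subseteq>X. (\<exists>\<^sub>F i in F. i \<in> Y) \<and> (\<exists>\<^sub>F i in F. i \<in> X - Y)"
  shows "prodF \<Turnstile>\<^sub>m SCP L"
  unfolding models_def
proof (clarify)
  fix \<sigma> r and v :: "nat \<Rightarrow> ('i \<Rightarrow> 'a) set"
  assume \<sigma>: "(\<sigma>, r) \<in> SCP L" and v: "range v \<subseteq> mdom prodF"
  obtain xs ys \<phi> Ds \<psi>s where eq: "\<sigma> = scp_sentence xs ys \<phi> Ds \<psi>s" "r = 0"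
    and len: "length Ds \<ge> 2" "length \<psi>s = length Ds"
    and pal: "\<And>\<theta>. \<theta> \<in> set (\<phi> # \<psi>s) \<Longrightarrow> palyutin L \<theta>"
    and D: "\<And>D. D \<in> set Ds \<Longrightarrow> unary_connective D \<and> antimono D"
    using \<sigma> unfolding SCP_def by blast
  show "val prodF v \<sigma> \<le> r"
    unfolding eq scp_sentence_def
  proof (rule val_SupsF_le[OF mdom_prodF_nonempty _ v])
    fix v' :: "nat \<Rightarrow> ('i \<Rightarrow> 'a) set" assume "range v' \<subseteq> mdom prodF"
    then show "val prodF v' (DiffF (InfsF xs (MaxF (\<phi> # map2 UnF Ds \<psi>s)))
                     (MaxF (map2 (\<lambda>D \<psi>. InfsF xs (MaxF [\<phi>, UnF D \<psi>])) Ds \<psi>s))) \<le> 0"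
      unfolding val_DiffF diff_le_0_iff_le using len pal D by (intro scp_matrix_le assms) auto
  qed
qed

end

theorem lemma3p7:
  fixes L :: "('f, 'p) msig"
    and M :: "'i \<Rightarrow> ('f, 'p, 'a) mstr"
    and F :: "'i filter"
    and N :: "nat \<Rightarrow> ('f, 'p, 'b) mstr"
  assumes "metric_signature L"
  shows "((\<forall>i. metric_structure L (M i)) \<longrightarrow> F \<noteq> bot \<longrightarrow> atomless (two_power F) \<longrightarrow>
            reduced_product F M \<Turnstile>\<^sub>m SCP L)
       \<and> ((\<forall>i. metric_structure L (N i)) \<longrightarrow> reduced_product cofinite N \<Turnstile>\<^sub>m SCP L)"
proof (intro conjI impI)
  assume "\<forall>i. metric_structure L (M i)" "F \<noteq> bot" "atomless (two_power F)"
  then show "reduced_product F M \<Turnstile>\<^sub>m SCP L"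
    using assms by (intro structure_family.reduced_product_SCP atomless_two_power_split)
      (simp_all add: structure_family_def)
next
  assume "\<forall>i. metric_structure L (N i)"
  \<comment> \<open>Properness of \<open>cofinite\<close>, one of the assumptions of
    \<open>structure_family\<close>, holds because \<open>nat\<close> is infinite.\<close>
  then show "reduced_product cofinite N \<Turnstile>\<^sub>m SCP L"
    using assms by (intro structure_family.reduced_product_SCP cofinite_split)
      (simp_all add: structure_family_def)
qed

end
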